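(* Let $(M,\omega)$ be a connected closed symplectic manifold, not simply connected, which is spherically monotone (resp. spherically negative monotone) with monotonicity constant $\lambda$. If $\pi_1(M)$ contains no subgroup isomorphic to $\mathbb{Z}\oplus\mathbb{Z}$, then $(M,\omega)$ is toroidally monotone (resp. toroidally negative monotone) with the same monotonicity constant $\lambda$.
   Context: For $\alpha\in[S^1,M]$ a free homotopy class of loops, $\mathcal{L}_\alpha M$ is the component of the free loop space consisting of loops in class $\alpha$. The Hurewicz map $h_S\colon\pi_2(M)\to H_2(M;\mathbb{Z})$ sends $[w]$ to $w_*([S^2])$; the map $h_T\colon\pi_1(\mathcal{L}_\alpha M)\to H_2(M;\mathbb{Z})$ sends the class of a loop of loops, viewed as a map $w\colon S^1\times S^1\to M$, to $w_*([S^1\times S^1])$. Let $c_1=c_1(M,\omega)\in H^2(M;\mathbb{Z})$ be the first Chern class of $TM$ with respect to an almost complex structure compatible with $\omega$. Restriction of a degree-2 class to a subgroup of $H_2(M;\mathbb{Z})$ is via the Kronecker pairing. $(M,\omega)$ is spherically monotone (resp. spherically negative monotone) with constant $\lambda$ if $\lambda\ge 0$ (resp. $\lambda<0$) and $[\omega]|_{h_S(\pi_2(M))}=\lambda c_1|_{h_S(\pi_2(M))}$. It is toroidally monotone (resp. toroidally negative monotone) with constant $\lambda$ if $\lambda\ge 0$ (resp. $\lambda<0$) and $[\omega]|_{h_T(\pi_1(\mathcal{L}_\alpha M))}=\lambda c_1|_{h_T(\pi_1(\mathcal{L}_\alpha M))}$ for all $\alpha\in[S^1,M]$. *)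

theory Defs
  imports "HOL-Homology.Homology" "HOL-Complex_Analysis.Complex_Analysis"
begin

section \<open>Smooth manifolds\<close>

text \<open>For open \<open>S\<close> in a finite-dimensional space.  Derivatives are real (Frechet) derivatives,
  also when the spaces happen to be complex.\<close>

fun Ck_on :: "nat \<Rightarrow> 'e::real_normed_vector set \<Rightarrow> ('e \<Rightarrow> 'f::real_normed_vector) \<Rightarrow> bool" where
  "Ck_on 0 S f \<longleftrightarrow> continuous_on S f"
| "Ck_on (Suc k) S f \<longleftrightarrow>
     (\<forall>x\<in>S. f differentiable (at x)) \<and> (\<forall>v. Ck_on k S (\<lambda>x. frechet_derivative f (at x) v))"

definition smooth_on :: "'e::real_normed_vector set \<Rightarrow> ('e \<Rightarrow> 'f::real_normed_vector) \<Rightarrow> bool" where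
  "smooth_on S f \<longleftrightarrow> (\<forall>k. Ck_on k S f)"

text \<open>A chart is a pair \<open>(U, \<phi>)\<close>, where only the values of \<open>\<phi>\<close> on \<open>U\<close> matter.\<close>

type_synonym ('a, 'e) chart = "'a set \<times> ('a \<Rightarrow> 'e)"

definition chart_change :: "('a, 'e) chart \<Rightarrow> ('a, 'e) chart \<Rightarrow> 'e \<Rightarrow> 'e" where
  "chart_change c d = snd d \<circ> inv_into (fst c) (snd c)"

definition smooth_manifold ::
    "'a::topological_space set \<Rightarrow> ('a, 'e::euclidean_space) chart set \<Rightarrow> bool" where
  "smooth_manifold M A \<longleftrightarrow>
     Hausdorff_space (top_of_set M) \<and> second_countable (top_of_set M) \<and>
     (\<Union>c\<in>A. fst c) = M \<and>
     (\<forall>c\<in>A. openin (top_of_set M) (fst c) \<and> open (snd c ` fst c) \<and>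
        homeomorphic_map (top_of_set (fst c)) (top_of_set (snd c ` fst c)) (snd c)) \<and>
     (\<forall>c\<in>A. \<forall>d\<in>A. smooth_on (snd c ` (fst c \<inter> fst d)) (chart_change c d))"

section \<open>Symplectic forms and compatible almost complex structures\<close>

text \<open>Tensor fields are given by their local representatives: for a chart \<open>c = (U, \<phi>)\<close> in the atlas
  and \<open>x \<in> \<phi>(U)\<close>, \<open>\<omega> c x\<close> is the form on the tangent space at \<open>\<phi>\<inverse>(x)\<close>, read in the coordinates
  of \<open>c\<close>.  The representatives are related by the differentials of the chart changes.\<close>

type_synonym ('a, 'e) two_tensor = "('a, 'e) chart \<Rightarrow> 'e \<Rightarrow> 'e \<Rightarrow> 'e \<Rightarrow> real"
type_synonym ('a, 'e) endo_field = "('a, 'e) chart \<Rightarrow> 'e \<Rightarrow> 'e \<Rightarrow> 'e"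

definition two_form :: "('a, 'e::euclidean_space) chart set \<Rightarrow> ('a, 'e) two_tensor \<Rightarrow> bool" where
  "two_form A \<omega> \<longleftrightarrow>
     (\<forall>c\<in>A. (\<forall>x \<in> snd c ` fst c. bilinear (\<omega> c x) \<and> (\<forall>u. \<omega> c x u u = 0)) \<and>
             (\<forall>u v. smooth_on (snd c ` fst c) (\<lambda>x. \<omega> c x u v))) \<and>
     (\<forall>c\<in>A. \<forall>d\<in>A. \<forall>x \<in> snd c ` (fst c \<inter> fst d). \<forall>u v.
        \<omega> c x u v = \<omega> d (chart_change c d x) (frechet_derivative (chart_change c d) (at x) u)
                                           (frechet_derivative (chart_change c d) (at x) v))"

definition symplectic_form :: "('a, 'e::euclidean_space) chart set \<Rightarrow> ('a, 'e) two_tensor \<Rightarrow> bool" where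
  "symplectic_form A \<omega> \<longleftrightarrow> two_form A \<omega> \<and>
     (\<forall>c\<in>A. \<forall>x \<in> snd c ` fst c.
        (\<forall>u. u \<noteq> 0 \<longrightarrow> (\<exists>v. \<omega> c x u v \<noteq> 0)) \<and>
        (\<forall>u v w. frechet_derivative (\<lambda>y. \<omega> c y v w) (at x) u
               + frechet_derivative (\<lambda>y. \<omega> c y w u) (at x) v
               + frechet_derivative (\<lambda>y. \<omega> c y u v) (at x) w = 0))"

definition closed_symplectic_manifold ::
    "'a::topological_space set \<Rightarrow> ('a, 'e::euclidean_space) chart set \<Rightarrow> ('a, 'e) two_tensor \<Rightarrow> bool" where
  "closed_symplectic_manifold M A \<omega> \<longleftrightarrow>
     smooth_manifold M A \<and> compact M \<and> symplectic_form A \<omega>"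

definition almost_complex_structure ::
    "('a, 'e::euclidean_space) chart set \<Rightarrow> ('a, 'e) endo_field \<Rightarrow> bool" where
  "almost_complex_structure A J \<longleftrightarrow>
     (\<forall>c\<in>A. (\<forall>x \<in> snd c ` fst c. linear (J c x) \<and> (\<forall>u. J c x (J c x u) = - u)) \<and>
             (\<forall>u. smooth_on (snd c ` fst c) (\<lambda>x. J c x u))) \<and>
     (\<forall>c\<in>A. \<forall>d\<in>A. \<forall>x \<in> snd c ` (fst c \<inter> fst d). \<forall>u.
        frechet_derivative (chart_change c d) (at x) (J c x u) =
        J d (chart_change c d x) (frechet_derivative (chart_change c d) (at x) u))"

definition compatible_acs ::
    "('a, 'e::euclidean_space) chart set \<Rightarrow> ('a, 'e) two_tensor \<Rightarrow> ('a, 'e) endo_field \<Rightarrow> bool" where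
  "compatible_acs A \<omega> J \<longleftrightarrow> almost_complex_structure A J \<and>
     (\<forall>c\<in>A. \<forall>x \<in> snd c ` fst c.
        (\<forall>u v. \<omega> c x (J c x u) (J c x v) = \<omega> c x u v) \<and>
        (\<forall>u. u \<noteq> 0 \<longrightarrow> \<omega> c x u (J c x u) > 0))"

section \<open>Singular cohomology and the Kronecker pairing\<close>

type_synonym ('a, 'r) cochain = "((nat \<Rightarrow> real) \<Rightarrow> 'a) \<Rightarrow> 'r"

definition cochain_eval :: "('a, 'r::comm_ring_1) cochain \<Rightarrow> 'a chain \<Rightarrow> 'r" where
  "cochain_eval f z = (\<Sum>\<sigma>\<in>Poly_Mapping.keys z. of_int (Poly_Mapping.lookup z \<sigma>) * f \<sigma>)"

definition cocycle :: "nat \<Rightarrow> 'a topology \<Rightarrow> ('a, 'r::comm_ring_1) cochain \<Rightarrow> bool" where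
  "cocycle p X f \<longleftrightarrow>
     (\<forall>\<sigma>. singular_simplex (Suc p) X \<sigma> \<longrightarrow> cochain_eval f (chain_boundary (Suc p) (frag_of \<sigma>)) = 0)"

text \<open>Cochains are total functions, so this also identifies cochains that agree on all singular
  simplices of \<open>X\<close>.\<close>

definition cohomologous ::
    "nat \<Rightarrow> 'a topology \<Rightarrow> ('a, 'r::comm_ring_1) cochain \<Rightarrow> ('a, 'r) cochain \<Rightarrow> bool" where
  "cohomologous p X f g \<longleftrightarrow>
     (\<exists>h. \<forall>\<sigma>. singular_simplex p X \<sigma> \<longrightarrow> f \<sigma> - g \<sigma> = cochain_eval h (chain_boundary p (frag_of \<sigma>)))"

text \<open>The underlying set of \<open>H\<^sup>p(X; 'r)\<close>.\<close>

definition cohomology :: "nat \<Rightarrow> 'a topology \<Rightarrow> ('a, 'r::comm_ring_1) cochain set set" where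
  "cohomology p X =
     {f. cocycle p X f} // {(f, g). cocycle p X f \<and> cocycle p X g \<and> cohomologous p X f g}"

text \<open>Elements of the library's homology groups are cosets, i.e. sets of cycles.\<close>

definition kronecker :: "('a, 'r::comm_ring_1) cochain set \<Rightarrow> 'a chain set \<Rightarrow> 'r" where
  "kronecker \<Phi> a = (THE r. \<forall>f\<in>\<Phi>. \<forall>z\<in>a. cochain_eval f z = r)"

section \<open>The de Rham class of a 2-form\<close>

text \<open>Affine parametrisation of the standard 2-simplex by the triangle
  \<open>{(s, t). 0 \<le> s \<and> 0 \<le> t \<and> s + t \<le> 1}\<close>, with the orientation given by the order of the vertices.\<close>

definition triangle_param :: "real \<times> real \<Rightarrow> nat \<Rightarrow> real" where
  "triangle_param = (\<lambda>(s, t) i. if i = 0 then 1 - s - t else if i = 1 then s else if i = 2 then t else 0)"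

text \<open>Smoothness of a map on the closed triangle means that it locally extends to smooth maps on
  open subsets of the plane.\<close>

definition smooth_2simplex ::
    "('a, 'e::euclidean_space) chart set \<Rightarrow> ((nat \<Rightarrow> real) \<Rightarrow> 'a) \<Rightarrow> bool" where
  "smooth_2simplex A \<sigma> \<longleftrightarrow>
     (let T = {(s, t). 0 \<le> s \<and> 0 \<le> t \<and> s + t \<le> 1} in
      \<forall>q\<in>T. \<exists>c\<in>A. \<exists>N g. open N \<and> q \<in> N \<and> smooth_on N g \<and>
        (\<forall>y \<in> N \<inter> T. \<sigma> (triangle_param y) \<in> fst c \<and> g y = snd c (\<sigma> (triangle_param y))))"

text \<open>The function \<open>r\<close> with \<open>f\<^sup>*\<omega> = r ds \<and> dt\<close>; it does not depend on the chart.\<close>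

definition pullback_density ::
    "('a, 'e::euclidean_space) chart set \<Rightarrow> ('a, 'e) two_tensor \<Rightarrow> (real \<times> real \<Rightarrow> 'a) \<Rightarrow> real \<times> real \<Rightarrow> real" where
  "pullback_density A \<omega> f y =
     (THE r. \<forall>c\<in>A. f y \<in> fst c \<longrightarrow>
        r = \<omega> c (snd c (f y)) (frechet_derivative (snd c \<circ> f) (at y) (1, 0))
                             (frechet_derivative (snd c \<circ> f) (at y) (0, 1)))"

definition form_integral ::
    "('a, 'e::euclidean_space) chart set \<Rightarrow> ('a, 'e) two_tensor \<Rightarrow> ('a, real) cochain" where
  "form_integral A \<omega> \<sigma> =
     integral {(s, t). 0 < s \<and> 0 < t \<and> s + t < 1} (pullback_density A \<omega> (\<sigma> \<circ> triangle_param))"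

text \<open>By de Rham's theorem, a closed form has exactly one class in \<open>H\<^sup>2(M; \<real>)\<close> with this property.\<close>

definition de_rham_class ::
    "'a::topological_space set \<Rightarrow> ('a, 'e::euclidean_space) chart set \<Rightarrow> ('a, 'e) two_tensor \<Rightarrow>
     ('a, real) cochain set \<Rightarrow> bool" where
  "de_rham_class M A \<omega> \<Omega> \<longleftrightarrow> \<Omega> \<in> cohomology 2 (top_of_set M) \<and>
     (\<forall>z. singular_relcycle 2 (top_of_set M) {} z \<and> (\<forall>\<sigma>\<in>Poly_Mapping.keys z. smooth_2simplex A \<sigma>) \<longrightarrow>
        kronecker \<Omega> (homologous_rel_set 2 (top_of_set M) {} z) = cochain_eval (form_integral A \<omega>) z)"

section \<open>The first Chern class\<close>

text \<open>A complex frame of the tangent space at \<open>p\<close> is a complex-linear isomorphism from \<open>\<complex>\<^sup>n\<close> onto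
  it (with complex structure \<open>J\<close>), again given by its representatives in the charts around \<open>p\<close>.
  From here on manifolds are modelled on the real vector space underlying \<open>\<complex>\<^sup>n\<close>, that is on
  \<open>\<real>\<^sup>2\<^sup>n\<close>; chart changes are only real smooth.\<close>

type_synonym ('a, 'n) frame = "('a, complex^'n) chart \<Rightarrow> complex^'n \<Rightarrow> complex^'n"

definition complex_frame ::
    "('a, complex^'n) chart set \<Rightarrow> ('a, complex^'n) endo_field \<Rightarrow> 'a \<Rightarrow> ('a, 'n::finite) frame \<Rightarrow> bool" where
  "complex_frame A J p F \<longleftrightarrow>
     (\<forall>c\<in>A. p \<in> fst c \<longrightarrow>
        linear (F c) \<and> bij (F c) \<and> (\<forall>z. F c (\<i> *s z) = J c (snd c p) (F c z))) \<and>
     (\<forall>c\<in>A. \<forall>d\<in>A. p \<in> fst c \<inter> fst d \<longrightarrow>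
        F d = frechet_derivative (chart_change c d) (at (snd c p)) \<circ> F c)"

definition frame_along ::
    "('a, complex^'n) chart set \<Rightarrow> ('a, complex^'n) endo_field \<Rightarrow> nat \<Rightarrow> ((nat \<Rightarrow> real) \<Rightarrow> 'a) \<Rightarrow>
     ((nat \<Rightarrow> real) \<Rightarrow> ('a, 'n::finite) frame) \<Rightarrow> bool" where
  "frame_along A J p \<sigma> F \<longleftrightarrow>
     (\<forall>t\<in>standard_simplex p. complex_frame A J (\<sigma> t) (F t)) \<and>
     (\<forall>c\<in>A. \<forall>z. continuous_on {t \<in> standard_simplex p. \<sigma> t \<in> fst c} (\<lambda>t. F t c z))"

text \<open>The determinant of the change of frame \<open>F\<inverse>G\<close> in \<open>GL(n, \<complex>)\<close>; it does not depend on the chart.\<close>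

definition frame_det ::
    "('a, complex^'n) chart set \<Rightarrow> 'a \<Rightarrow> ('a, 'n::finite) frame \<Rightarrow> ('a, 'n) frame \<Rightarrow> complex" where
  "frame_det A p F G =
     (THE r. \<forall>c\<in>A. p \<in> fst c \<longrightarrow> r = det (matrix (inv_into UNIV (F c) \<circ> G c)))"

definition edge_param :: "real \<Rightarrow> nat \<Rightarrow> real" where
  "edge_param u i = (if i = 0 then 1 - u else if i = 1 then u else 0)"

text \<open>\<open>F\<close> is a frame along the 2-simplex \<open>\<sigma>\<close>, and \<open>E\<close> assigns a frame to each singular 1-simplex.\<close>

definition face_det_path ::
    "('a, complex^'n) chart set \<Rightarrow> ((nat \<Rightarrow> real) \<Rightarrow> 'a) \<Rightarrow> ((nat \<Rightarrow> real) \<Rightarrow> ('a, 'n::finite) frame) \<Rightarrow>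
     (((nat \<Rightarrow> real) \<Rightarrow> 'a) \<Rightarrow> (nat \<Rightarrow> real) \<Rightarrow> ('a, 'n) frame) \<Rightarrow> nat \<Rightarrow> real \<Rightarrow> complex" where
  "face_det_path A \<sigma> F E k u =
     (let \<tau> = singular_face 2 k \<sigma>; t = edge_param u
      in frame_det A (\<tau> t) (F (simplical_face k t)) (E \<tau> t))"

text \<open>The obstruction cocycle of \<open>det TM\<close>: choose complex frames \<open>V\<close> at the points of \<open>M\<close> and
  extend them to frames \<open>E\<close> along all singular 1-simplices.  The value on a 2-simplex \<open>\<sigma>\<close> is the
  degree of the determinant of the boundary frames, relative to a frame \<open>F\<close> along the whole of \<open>\<sigma>\<close>,
  as a map from the boundary, traversed as \<open>v\<^sub>0 \<rightarrow> v\<^sub>1 \<rightarrow> v\<^sub>2 \<rightarrow> v\<^sub>0\<close>, to \<open>\<complex> - {0}\<close>.  The degree is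
  independent of \<open>F\<close>.  With this sign, \<open>c\<^sub>1\<close> of the tangent bundle of the Riemann sphere is 2.\<close>

definition chern_cochain ::
    "'a::topological_space set \<Rightarrow> ('a, complex^'n::finite) chart set \<Rightarrow> ('a, complex^'n) endo_field \<Rightarrow>
     ('a, int) cochain \<Rightarrow> bool" where
  "chern_cochain M A J \<kappa> \<longleftrightarrow>
     (\<exists>(V :: 'a \<Rightarrow> ('a, 'n) frame) E.
        (\<forall>\<tau>. singular_simplex 1 (top_of_set M) \<tau> \<longrightarrow>
           frame_along A J 1 \<tau> (E \<tau>) \<and>
           (\<forall>u\<in>{0, 1}. \<forall>c\<in>A. \<tau> (edge_param u) \<in> fst c \<longrightarrow>
              E \<tau> (edge_param u) c = V (\<tau> (edge_param u)) c)) \<and>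
        (\<forall>\<sigma>. singular_simplex 2 (top_of_set M) \<sigma> \<longrightarrow>
           (\<exists>F. frame_along A J 2 \<sigma> F \<and>
              of_int (\<kappa> \<sigma>) =
                winding_number (face_det_path A \<sigma> F E 2 +++ face_det_path A \<sigma> F E 0
                                +++ reversepath (face_det_path A \<sigma> F E 1)) 0)))"

text \<open>All obstruction cochains are cocycles and lie in the same class in \<open>H\<^sup>2(M; \<int>)\<close>.\<close>

definition first_chern_class ::
    "'a::topological_space set \<Rightarrow> ('a, complex^'n::finite) chart set \<Rightarrow> ('a, complex^'n) endo_field \<Rightarrow>
     ('a, int) cochain set \<Rightarrow> bool" where
  "first_chern_class M A J C \<longleftrightarrow>
     C \<in> cohomology 2 (top_of_set M) \<and> (\<exists>\<kappa>\<in>C. chern_cochain M A J \<kappa>)"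

section \<open>Spherical and toroidal classes\<close>

text \<open>The choice of the generator, i.e. of the orientation of the sphere, does not affect the set
  of spherical classes below.\<close>

definition sphere_fundamental_class :: "(nat \<Rightarrow> real) chain set" where
  "sphere_fundamental_class =
     (SOME a. a \<in> carrier (homology_group 2 (nsphere 2)) \<and>
              generate (homology_group 2 (nsphere 2)) {a} = carrier (homology_group 2 (nsphere 2)))"

text \<open>\<open>h\<^sub>S(\<pi>\<^sub>2(M))\<close> for path-connected \<open>M\<close>, where the base point plays no role.\<close>

definition spherical_classes :: "'a::topological_space set \<Rightarrow> 'a chain set set" where
  "spherical_classes M =
     {hom_induced 2 (nsphere 2) {} (top_of_set M) {} w sphere_fundamental_class |
        w. continuous_map (nsphere 2) (top_of_set M) w}"

definition torus :: "(complex \<times> complex) set" where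
  "torus = sphere 0 1 \<times> sphere 0 1"

definition torus_param :: "real \<times> real \<Rightarrow> complex \<times> complex" where
  "torus_param = (\<lambda>(s, t). (cis (2 * pi * s), cis (2 * pi * t)))"

text \<open>The unit square is cut along its diagonal into the triangles with vertices
  \<open>(0,0), (1,0), (1,1)\<close> and \<open>(0,0), (0,1), (1,1)\<close>; the second is negatively oriented.\<close>

definition torus_fundamental_class :: "(complex \<times> complex) chain set" where
  "torus_fundamental_class = homologous_rel_set 2 (top_of_set torus) {}
     (frag_of (restrict (\<lambda>x. torus_param (x 1 + x 2, x 2)) (standard_simplex 2))
    - frag_of (restrict (\<lambda>x. torus_param (x 2, x 1 + x 2)) (standard_simplex 2)))"

text \<open>The set \<open>[S\<^sup>1, M]\<close>; loops are parametrised by the unit interval.\<close>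

definition free_loop_classes :: "'a::topological_space set \<Rightarrow> (real \<Rightarrow> 'a) set set" where
  "free_loop_classes M =
     {p. path p \<and> path_image p \<subseteq> M \<and> pathfinish p = pathstart p} // {(p, q). homotopic_loops M p q}"

text \<open>\<open>h\<^sub>T(\<pi>\<^sub>1(\<L>\<^sub>\<alpha> M))\<close>: the first circle factor is the time of the loop of loops, the second one that of
  the loops in the class \<open>\<alpha>\<close>.  As \<open>\<L>\<^sub>\<alpha> M\<close> is path-connected, its base point plays no role.\<close>

definition toroidal_classes :: "'a::topological_space set \<Rightarrow> (real \<Rightarrow> 'a) set \<Rightarrow> 'a chain set set" where
  "toroidal_classes M \<alpha> =
     {hom_induced 2 (top_of_set torus) {} (top_of_set M) {} w torus_fundamental_class |
        w. continuous_map (top_of_set torus) (top_of_set M) w \<and>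
           (\<forall>z\<in>sphere 0 1. (\<lambda>t. w (z, cis (2 * pi * t))) \<in> \<alpha>)}"

section \<open>Monotonicity\<close>

text \<open>\<open>[\<omega>] = \<lambda> c\<^sub>1\<close> on a set \<open>S\<close> of classes in \<open>H\<^sub>2(M; \<int>)\<close>.  The universally quantified \<open>\<Omega>\<close> and \<open>C\<close>
  stand for the unique classes \<open>[\<omega>]\<close> and \<open>c\<^sub>1\<close>; compatible \<open>J\<close> always exist and \<open>c\<^sub>1\<close> does not
  depend on the choice of \<open>J\<close>.\<close>

definition proportional_on ::
    "'a::topological_space set \<Rightarrow> ('a, complex^'n::finite) chart set \<Rightarrow> ('a, complex^'n) two_tensor \<Rightarrow>
     real \<Rightarrow> 'a chain set set \<Rightarrow> bool" where
  "proportional_on M A \<omega> l S \<longleftrightarrow>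
     (\<forall>\<Omega> J C. de_rham_class M A \<omega> \<Omega> \<and> compatible_acs A \<omega> J \<and> first_chern_class M A J C \<longrightarrow>
        (\<forall>a\<in>S. kronecker \<Omega> a = l * of_int (kronecker C a)))"

definition spherically_monotone where
  "spherically_monotone M A \<omega> l \<longleftrightarrow> l \<ge> 0 \<and> proportional_on M A \<omega> l (spherical_classes M)"

definition spherically_negative_monotone where
  "spherically_negative_monotone M A \<omega> l \<longleftrightarrow> l < 0 \<and> proportional_on M A \<omega> l (spherical_classes M)"

definition toroidally_monotone where
  "toroidally_monotone M A \<omega> l \<longleftrightarrow> l \<ge> 0 \<and>
     (\<forall>\<alpha>\<in>free_loop_classes M. proportional_on M A \<omega> l (toroidal_classes M \<alpha>))"

definition toroidally_negative_monotone where
  "toroidally_negative_monotone M A \<omega> l \<longleftrightarrow> l < 0 \<and>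
     (\<forall>\<alpha>\<in>free_loop_classes M. proportional_on M A \<omega> l (toroidal_classes M \<alpha>))"

section \<open>The fundamental group\<close>

definition based_homotopy :: "'a::topological_space set \<Rightarrow> 'a \<Rightarrow> ((real \<Rightarrow> 'a) \<times> (real \<Rightarrow> 'a)) set" where
  "based_homotopy M x0 = {(p, q). homotopic_paths M p q \<and> pathstart p = x0 \<and> pathfinish p = x0}"

definition fundamental_group :: "'a::topological_space set \<Rightarrow> 'a \<Rightarrow> (real \<Rightarrow> 'a) set monoid" where
  "fundamental_group M x0 =
     \<lparr>carrier = {p. path p \<and> path_image p \<subseteq> M \<and> pathstart p = x0 \<and> pathfinish p = x0}
                  // based_homotopy M x0,
      monoid.mult = (\<lambda>P Q. \<Union>p\<in>P. \<Union>q\<in>Q. based_homotopy M x0 `` {p +++ q}),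
      one = based_homotopy M x0 `` {\<lambda>_. x0}\<rparr>"

end

theory Submission
  imports Defs
begin

text \<open>A map \<open>w\<close> from the torus is a biperiodic map \<open>G\<close> from the plane, and the loops \<open>t \<mapsto> G (t v)\<close> for
  \<open>v\<close> in the lattice define a homomorphism from \<open>\<int>\<^sup>2\<close> to \<open>\<pi>\<^sub>1(M)\<close>.  It cannot be injective, so that
  some \<open>v = (m, n) \<noteq> 0\<close> gives a null-homotopic loop.  Put \<open>v' = (-n, m)\<close> and let \<open>F\<close> be the torus
  \<open>(s, t) \<mapsto> G (s v + t v')\<close>.  Capping off its null-homotopic circle shows that \<open>F\<close> has the homology class
  of a cycle that comes from the sphere.

  On the other hand, for a 2-cocycle \<open>f\<close> on \<open>M\<close>, the value of \<open>f\<close> on the image under \<open>G\<close> of the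
  triangle \<open>(0, v, v + w)\<close> is a 2-cocycle of the group \<open>\<int>\<^sup>2\<close>, and its antisymmetrisation is the
  value of \<open>f\<close> on the torus spanned by \<open>v\<close> and \<open>w\<close>.  The antisymmetrisation of a 2-cocycle is bilinear
  and alternating, whence every cohomology class takes on \<open>F\<close> the value \<open>m\<^sup>2 + n\<^sup>2\<close> times that on \<open>w\<close>.
  Dividing by this positive number transfers the proportionality from spheres to tori.\<close>

section \<open>Evaluation of cohomology classes on cycles\<close>

lemma cochain_eval_mono_neutral:
  assumes "finite S" "Poly_Mapping.keys z \<subseteq> S"
  shows "cochain_eval f z = (\<Sum>\<sigma>\<in>S. of_int (Poly_Mapping.lookup z \<sigma>) * f \<sigma>)"
  unfolding cochain_eval_def using assms
  by (intro sum.mono_neutral_left) (auto simp: in_keys_iff)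

lemma cochain_eval_diff: "cochain_eval f (a - b) = cochain_eval f a - cochain_eval f b"
proof -
  let ?S = "Poly_Mapping.keys a \<union> Poly_Mapping.keys b"
  have "Poly_Mapping.keys (a - b) \<subseteq> ?S"
    by (rule keys_diff)
  then have "cochain_eval f (a - b) = (\<Sum>\<sigma>\<in>?S. of_int (Poly_Mapping.lookup (a - b) \<sigma>) * f \<sigma>)"
    by (intro cochain_eval_mono_neutral finite_UnI finite_keys)
  moreover have "cochain_eval f a = (\<Sum>\<sigma>\<in>?S. of_int (Poly_Mapping.lookup a \<sigma>) * f \<sigma>)"
    "cochain_eval f b = (\<Sum>\<sigma>\<in>?S. of_int (Poly_Mapping.lookup b \<sigma>) * f \<sigma>)"
    by (intro cochain_eval_mono_neutral finite_UnI finite_keys Un_upper1 Un_upper2)+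
  ultimately show ?thesis
    by (simp only: lookup_minus of_int_diff left_diff_distrib sum_subtractf)
qed

lemma cochain_eval_0 [simp]: "cochain_eval f 0 = 0"
  by (simp add: cochain_eval_def)

lemma cochain_eval_minus: "cochain_eval f (- a) = - cochain_eval f a"
  using cochain_eval_diff [of f 0 a] by simp

lemma cochain_eval_add: "cochain_eval f (a + b) = cochain_eval f a + cochain_eval f b"
  using cochain_eval_diff [of f a "- b"] by (simp add: cochain_eval_minus)

lemma cochain_eval_of [simp]: "cochain_eval f (frag_of \<sigma>) = f \<sigma>"
  by (simp add: cochain_eval_def)

text \<open>Both sides are additive in \<open>z\<close>, so generators suffice. The point is to pass
  from a chain to single simplices, where \<open>cocycle\<close> and \<open>cohomologous\<close> are
  formulated.\<close>

lemma cochain_eval_boundary: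
  "cochain_eval h (chain_boundary p z) = cochain_eval (\<lambda>\<sigma>. cochain_eval h (chain_boundary p (frag_of \<sigma>))) z"
  by (rule frag_induction [of z UNIV]) (auto simp: chain_boundary_diff cochain_eval_diff)

lemma cocycle_eval_boundary:
  assumes "cocycle p X f" "singular_chain (Suc p) X d"
  shows "cochain_eval f (chain_boundary (Suc p) d) = 0"
  unfolding cochain_eval_boundary [of f "Suc p" d] unfolding cochain_eval_def
  using assms by (intro sum.neutral) (auto simp: cocycle_def singular_chain_def cochain_eval_def)

lemma cohomologous_eval_cycle:
  assumes "cohomologous p X f g" "singular_relcycle p X {} z"
  shows "cochain_eval f z = cochain_eval g z"
proof -
  obtain h where h: "\<And>\<sigma>. singular_simplex p X \<sigma> \<Longrightarrow>
      f \<sigma> - g \<sigma> = cochain_eval h (chain_boundary p (frag_of \<sigma>))"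
    using assms by (auto simp: cohomologous_def)
  have "cochain_eval f z - cochain_eval g z
      = (\<Sum>\<sigma>\<in>Poly_Mapping.keys z. of_int (Poly_Mapping.lookup z \<sigma>) * (f \<sigma> - g \<sigma>))"
    by (simp add: cochain_eval_def right_diff_distrib sum_subtractf)
  also have "\<dots> = cochain_eval (\<lambda>\<sigma>. cochain_eval h (chain_boundary p (frag_of \<sigma>))) z"
    unfolding cochain_eval_def [of _ z] using assms(2) h
    by (intro sum.cong) (auto simp: singular_cycle singular_chain_def)
  also have "\<dots> = 0"
    using assms(2) by (simp add: singular_cycle flip: cochain_eval_boundary)
  finally show ?thesis by simp
qed

lemma cohomology_representative:
  assumes "\<Phi> \<in> cohomology p X"
  obtains f where "f \<in> \<Phi>" "cocycle p X f"
    "\<And>g. g \<in> \<Phi> \<Longrightarrow> cohomologous p X f g"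
proof -
  obtain f where "cocycle p X f"
    and \<Phi>: "\<Phi> = {(f, g). cocycle p X f \<and> cocycle p X g \<and> cohomologous p X f g} `` {f}"
    using assms by (auto simp: cohomology_def quotient_def)
  moreover have "cohomologous p X f f"
    by (auto simp: cohomologous_def cochain_eval_def intro!: exI [of _ "\<lambda>_. 0"])
  ultimately show ?thesis
    by (intro that [of f]) auto
qed

text \<open>This replaces the definite description in \<open>kronecker\<close> by a computation.
  Cohomologous cochains agree on cycles and a cocycle vanishes on boundaries, so every choice gives
  the value of one fixed cocycle \<open>f0\<close> on \<open>z\<close>.\<close>

lemma kronecker_cycle:
  assumes \<Phi>: "\<Phi> \<in> cohomology p X" and f: "f \<in> \<Phi>" and z: "singular_relcycle p X {} z"
  shows "kronecker \<Phi> (homologous_rel_set p X {} z) = cochain_eval f z"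
proof -
  obtain f0 where f0: "f0 \<in> \<Phi>" "cocycle p X f0" "\<And>g. g \<in> \<Phi> \<Longrightarrow> cohomologous p X f0 g"
    using cohomology_representative [OF \<Phi>] by blast
  have *: "cochain_eval g y = cochain_eval f0 z" if "g \<in> \<Phi>" "homologous_rel p X {} z y" for g y
  proof -
    have "singular_relboundary p X {} (z - y)"
      using that by (simp add: homologous_rel_def)
    then obtain d where d: "singular_chain (Suc p) X d" "chain_boundary (Suc p) d = z - y"
      by (auto simp: singular_boundary)
    have "singular_relcycle p X {} y"
      using z that(2) homologous_rel_singular_relcycle by blast
    then have "cochain_eval g y = cochain_eval f0 y"
      using cohomologous_eval_cycle f0(3) that(1) by metis
    also have "\<dots> = cochain_eval f0 z"
      using cocycle_eval_boundary [OF f0(2) d(1)] d(2) by (simp add: cochain_eval_diff)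
    finally show ?thesis .
  qed
  have "kronecker \<Phi> (homologous_rel_set p X {} z) = cochain_eval f0 z"
    unfolding kronecker_def
  proof (rule the_equality)
    show "\<forall>g\<in>\<Phi>. \<forall>y\<in>homologous_rel_set p X {} z. cochain_eval g y = cochain_eval f0 z"
      using * by auto
    show "r = cochain_eval f0 z"
      if "\<forall>g\<in>\<Phi>. \<forall>y\<in>homologous_rel_set p X {} z. cochain_eval g y = r" for r
      using that f0(1) by auto
  qed
  also have "\<dots> = cochain_eval f z"
    using cohomologous_eval_cycle [OF f0(3) [OF f] z] .
  finally show ?thesis .
qed

section \<open>Cocycles on the lattice\<close>

text \<open>The hypothesis is the 2-cocycle identity of group cohomology with trivial coefficients.
  Its instances for the triples \<open>(u, v, w)\<close>, \<open>(w, u, v)\<close> and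
  \<open>(u, w, v)\<close> are combined; since the group is abelian, the terms \<open>c u v\<close>
  and \<open>c (u + w) v\<close> cancel.\<close>

lemma antisymmetrized_2cocycle_add:
  fixes c :: "'z::ab_group_add \<Rightarrow> 'z \<Rightarrow> 'r::ab_group_add"
  assumes "\<And>u v w. c v w + c u (v + w) = c (u + v) w + c u v"
  shows "c (u + v) w - c w (u + v) = (c u w - c w u) + (c v w - c w v)"
proof -
  have 1: "c (u + v) w = c v w + c u (v + w) - c u v"
    using assms [of v w u] by (simp add: eq_diff_eq)
  have 2: "c w (u + v) = c (u + w) v + c w u - c u v"
    using assms [of u v w] by (simp add: eq_diff_eq algebra_simps)
  have 3: "c u (v + w) = c (u + w) v + c u w - c w v"
    using assms [of w v u] by (simp add: eq_diff_eq algebra_simps)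
  show ?thesis
    unfolding 1 2 3 by (simp add: algebra_simps)
qed

lemma additive_int_pair:
  fixes f :: "int \<times> int \<Rightarrow> 'r::comm_ring_1"
  assumes add: "\<And>u v. f (u + v) = f u + f v"
  shows "f (m, n) = of_int m * f (1, 0) + of_int n * f (0, 1)"
proof -
  have f0: "f 0 = 0"
    using add [of 0 0] by simp
  have *: "g k = of_int k * g 1" if "\<And>a b. g (a + b) = g a + g b" for g :: "int \<Rightarrow> 'r" and k
  proof (induction k rule: int_induct [where k = 0])
    case base
    then show ?case using that [of 0 0] by simp
  next
    case (step1 i)
    then show ?case using that [of i 1] by (simp add: algebra_simps)
  next
    case (step2 i)
    then show ?case using that [of "i - 1" 1] by (simp add: algebra_simps)
  qed
  have "f (m, n) = f (m, 0) + f (0, n)"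
    using add [of "(m, 0)" "(0, n)"] by simp
  moreover have "f (m, 0) = of_int m * f (1, 0)"
    by (rule *) (use add [of "(x, 0)" "(y, 0)" for x y] in simp)
  moreover have "f (0, n) = of_int n * f (0, 1)"
    by (rule *) (use add [of "(0, x)" "(0, y)" for x y] in simp)
  ultimately show ?thesis by simp
qed

text \<open>An alternating bilinear form on pairs of integers is the determinant times its value on
  the standard basis, and the matrix with columns \<open>(m, n)\<close> and \<open>(- n, m)\<close>
  has determinant \<open>m\<^sup>2 + n\<^sup>2\<close>.\<close>

lemma antisymmetrized_2cocycle_rotation:
  fixes c :: "int \<times> int \<Rightarrow> int \<times> int \<Rightarrow> 'r::comm_ring_1"
  assumes "\<And>u v w. c v w + c u (v + w) = c (u + v) w + c u v"
  shows "c (m, n) (- n, m) - c (- n, m) (m, n) = of_int (m\<^sup>2 + n\<^sup>2) * (c (1, 0) (0, 1) - c (0, 1) (1, 0))"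
proof -
  define T where "T v w = c v w - c w v" for v w
  have l: "T (m, n) w = of_int m * T (1, 0) w + of_int n * T (0, 1) w" for m n w
    by (rule additive_int_pair) (simp only: T_def antisymmetrized_2cocycle_add [OF assms])
  have a: "T v w = - T w v" for v w
    by (simp add: T_def)
  have r: "T v (m, n) = of_int m * T v (1, 0) + of_int n * T v (0, 1)" for m n v
    using l [of m n v] a [of v] by (simp add: algebra_simps)
  \<comment> \<open>Over a general commutative ring this does not follow from antisymmetry, which
    only gives twice the equation.\<close>
  have "T v v = 0" for v
    by (simp add: T_def)
  then have "T (m, n) (- n, m) = of_int (m\<^sup>2 + n\<^sup>2) * T (1, 0) (0, 1)"
    using a [of "(0, 1)" "(1, 0)"]
    by (simp add: l [of m n] r [of _ "- n" m] algebra_simps power2_eq_square)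
  then show ?thesis
    by (simp add: T_def)
qed

section \<open>Affine triangles and tetrahedra in the plane\<close>

text \<open>The affine simplex with vertices \<open>a\<close>, \<open>b\<close>, \<open>c\<close>,
  in barycentric coordinates, followed by \<open>G\<close>. Singular simplices are extensional
  functions; with \<open>restrict\<close>, maps that agree on the standard simplex give equal
  simplices.\<close>

definition tri :: "(real \<times> real \<Rightarrow> 'a) \<Rightarrow> real \<times> real \<Rightarrow> real \<times> real \<Rightarrow> real \<times> real \<Rightarrow> (nat \<Rightarrow> real) \<Rightarrow> 'a" where
  "tri G a b c = restrict (\<lambda>x. G (x 0 *\<^sub>R a + x 1 *\<^sub>R b + x 2 *\<^sub>R c)) (standard_simplex 2)"

definition tetra ::
    "(real \<times> real \<Rightarrow> 'a) \<Rightarrow> real \<times> real \<Rightarrow> real \<times> real \<Rightarrow> real \<times> real \<Rightarrow> real \<times> real \<Rightarrow> (nat \<Rightarrow> real) \<Rightarrow> 'a" where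
  "tetra G a b c d =
     restrict (\<lambda>x. G (x 0 *\<^sub>R a + x 1 *\<^sub>R b + x 2 *\<^sub>R c + x 3 *\<^sub>R d)) (standard_simplex 3)"

lemma standard_simplex_2D:
  assumes "x \<in> standard_simplex 2"
  shows "0 \<le> x i" "x i \<le> 1" "x 0 + x 1 + x 2 = 1"
  using assms by (auto simp: standard_simplex_def numeral_2_eq_2)

lemma continuous_map_simplex_coordinate:
  "continuous_map (subtopology (powertop_real UNIV) S) euclideanreal (\<lambda>x. x i)"
  by (intro continuous_map_from_subtopology continuous_map_product_projection) simp

lemma continuous_map_scaled_coordinate:
  "continuous_map (subtopology (powertop_real UNIV) S) euclidean (\<lambda>x. x i *\<^sub>R (a :: 'b::real_normed_vector))"
proof -
  have "continuous_map euclideanreal euclidean (\<lambda>r. r *\<^sub>R a)"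
    by (simp add: continuous_intros)
  from continuous_map_compose [OF continuous_map_simplex_coordinate this] show ?thesis
    by (simp add: o_def)
qed

lemma singular_simplex_tri:
  assumes "continuous_map euclidean X G"
  shows "singular_simplex 2 X (tri G a b c)"
proof -
  have "continuous_map (subtopology (powertop_real UNIV) (standard_simplex 2)) euclidean
      (\<lambda>x. x 0 *\<^sub>R a + x 1 *\<^sub>R b + x 2 *\<^sub>R c)"
    by (intro continuous_map_add continuous_map_scaled_coordinate)
  from continuous_map_compose [OF this assms]
  have "continuous_map (subtopology (powertop_real UNIV) (standard_simplex 2)) X (tri G a b c)"
    by (rule continuous_map_eq) (auto simp: tri_def)
  then show ?thesis
    by (simp add: singular_simplex_def tri_def)
qed

lemma singular_simplex_tetra:
  assumes "continuous_map euclidean X G"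
  shows "singular_simplex 3 X (tetra G a b c d)"
proof -
  have "continuous_map (subtopology (powertop_real UNIV) (standard_simplex 3)) euclidean
      (\<lambda>x. x 0 *\<^sub>R a + x 1 *\<^sub>R b + x 2 *\<^sub>R c + x 3 *\<^sub>R d)"
    by (intro continuous_map_add continuous_map_scaled_coordinate)
  from continuous_map_compose [OF this assms]
  have "continuous_map (subtopology (powertop_real UNIV) (standard_simplex 3)) X (tetra G a b c d)"
    by (rule continuous_map_eq) (auto simp: tetra_def)
  then show ?thesis
    by (simp add: singular_simplex_def tetra_def)
qed

text \<open>Barycentric coordinates sum to 1, so moving all vertices by \<open>v\<close> moves every
  point by \<open>v\<close>.\<close>

lemma tri_translate:
  assumes "\<And>y. G (y + v) = G y"
  shows "tri G (a + v) (b + v) (c + v) = tri G a b c"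
proof -
  have "x 0 *\<^sub>R (a + v) + x 1 *\<^sub>R (b + v) + x 2 *\<^sub>R (c + v) = x 0 *\<^sub>R a + x 1 *\<^sub>R b + x 2 *\<^sub>R c + v"
    if "x \<in> standard_simplex 2" for x
  proof -
    have "x 0 *\<^sub>R (a + v) + x 1 *\<^sub>R (b + v) + x 2 *\<^sub>R (c + v)
        = x 0 *\<^sub>R a + x 1 *\<^sub>R b + x 2 *\<^sub>R c + (x 0 + x 1 + x 2) *\<^sub>R v"
      by (simp add: algebra_simps)
    then show ?thesis
      using standard_simplex_2D(3) [OF that] by simp
  qed
  then show ?thesis
    unfolding tri_def by (intro restrict_ext) (simp add: assms)
qed

lemma singular_face_tetra:
  "singular_face 3 0 (tetra G a b c d) = tri G b c d"
  "singular_face 3 1 (tetra G a b c d) = tri G a c d"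
  "singular_face 3 2 (tetra G a b c d) = tri G a b d"
  "singular_face 3 3 (tetra G a b c d) = tri G a b c"
proof -
  have *: "simplical_face k x \<in> standard_simplex 3" if "x \<in> standard_simplex 2" "k \<le> 3" for k and x :: "nat \<Rightarrow> real"
    using simplical_face_in_standard_simplex [of 3 k x] that by simp
  show "singular_face 3 0 (tetra G a b c d) = tri G b c d"
    "singular_face 3 1 (tetra G a b c d) = tri G a c d"
    "singular_face 3 2 (tetra G a b c d) = tri G a b d"
    "singular_face 3 3 (tetra G a b c d) = tri G a b c"
    unfolding singular_face_def tri_def
    by (auto intro!: restrict_ext simp: tetra_def *) (auto simp: simplical_face_def)
qed

text \<open>The four terms are the values of \<open>f\<close> on the faces of
  \<open>tetra G a b c d\<close>, whose boundary a cocycle annihilates. For periodic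
  \<open>G\<close> this becomes the group cocycle identity.\<close>

lemma cocycle_tri:
  assumes "cocycle 2 X f" "continuous_map euclidean X G"
  shows "f (tri G b c d) - f (tri G a c d) + f (tri G a b d) - f (tri G a b c) = 0"
proof -
  have "{..3::nat} = {0, 1, 2, 3}"
    by auto
  then have "chain_boundary 3 (frag_of (tetra G a b c d))
      = frag_of (tri G b c d) - frag_of (tri G a c d) + frag_of (tri G a b d) - frag_of (tri G a b c)"
    by (simp add: chain_boundary_of singular_face_tetra del: One_nat_def)
  moreover have "cochain_eval f (chain_boundary 3 (frag_of (tetra G a b c d))) = 0"
    using assms singular_simplex_tetra by (fastforce simp: cocycle_def numeral_3_eq_3)
  ultimately show ?thesis
    by (simp add: cochain_eval_add cochain_eval_diff)
qed

text \<open>The square is cut along its diagonal as in \<open>torus_fundamental_class\<close>; the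
  minus sign corrects the orientation of the second triangle.\<close>

definition square_chain :: "(real \<times> real \<Rightarrow> 'a) \<Rightarrow> 'a chain" where
  "square_chain G = frag_of (tri G (0, 0) (1, 0) (1, 1)) - frag_of (tri G (0, 0) (0, 1) (1, 1))"

text \<open>The factor is the degree of the self-map of the torus induced by the linear
  substitution. It is obtained from the group cocycle of the lattice, without any degree
  theory.\<close>

lemma cochain_eval_square_chain_rotation:
  fixes G :: "real \<times> real \<Rightarrow> 'a" and f :: "('a, 'r::comm_ring_1) cochain"
  assumes f: "cocycle 2 X f" and G: "continuous_map euclidean X G"
    and per: "\<And>y i j. G (y + (of_int i, of_int j)) = G y"
  shows "cochain_eval f (square_chain (\<lambda>y. G (fst y *\<^sub>R (of_int m, of_int n) + snd y *\<^sub>R (- of_int n, of_int m))))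
       = of_int (m\<^sup>2 + n\<^sup>2) * cochain_eval f (square_chain G)"
proof -
  define \<iota> :: "int \<times> int \<Rightarrow> real \<times> real" where "\<iota> v = (of_int (fst v), of_int (snd v))" for v
  have \<iota>: "\<iota> (u + v) = \<iota> u + \<iota> v" for u v
    by (simp add: \<iota>_def)
  define c where "c v w = f (tri G 0 (\<iota> v) (\<iota> (v + w)))" for v w
  have "c v w + c u (v + w) = c (u + v) w + c u v" for u v w
  proof -
    have "tri G (0 + \<iota> u) (\<iota> v + \<iota> u) (\<iota> (v + w) + \<iota> u) = tri G 0 (\<iota> v) (\<iota> (v + w))"
      by (rule tri_translate) (simp add: per \<iota>_def)
    \<comment> \<open>The tetrahedron has the vertices \<open>0\<close>, \<open>\<iota> u\<close>,
      \<open>\<iota> (u + v)\<close>, \<open>\<iota> (u + v + w)\<close>. Its face opposite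
      \<open>0\<close> is the translate by \<open>\<iota> u\<close> of the triangle that defines
      \<open>c v w\<close>.\<close>
    then show ?thesis
      using cocycle_tri [OF f G, of "\<iota> u" "\<iota> (u + v)" "\<iota> (u + v + w)" 0]
      by (simp add: c_def \<iota> algebra_simps)
  qed
  from antisymmetrized_2cocycle_rotation [of c m n, OF this]
  have rot: "c (m, n) (- n, m) - c (- n, m) (m, n) = of_int (m\<^sup>2 + n\<^sup>2) * (c (1, 0) (0, 1) - c (0, 1) (1, 0))" .
  have "cochain_eval f (square_chain G) = c (1, 0) (0, 1) - c (0, 1) (1, 0)"
    by (simp add: square_chain_def cochain_eval_diff c_def \<iota>_def zero_prod_def)
  moreover have "tri (\<lambda>y. G (fst y *\<^sub>R v + snd y *\<^sub>R w)) (0, 0) (1, 0) (1, 1) = tri G 0 v (v + w)"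
    "tri (\<lambda>y. G (fst y *\<^sub>R v + snd y *\<^sub>R w)) (0, 0) (0, 1) (1, 1) = tri G 0 w (v + w)" for v w
    unfolding tri_def by (auto intro!: restrict_ext simp: algebra_simps)
  then have "cochain_eval f (square_chain (\<lambda>y. G (fst y *\<^sub>R v + snd y *\<^sub>R w)))
      = f (tri G 0 v (v + w)) - f (tri G 0 w (v + w))" for v w
    by (simp add: square_chain_def cochain_eval_diff)
  ultimately show ?thesis
    unfolding square_chain_def using rot by (simp only:) (simp add: c_def \<iota>_def add.commute)
qed

section \<open>The chain of a singular square\<close>

definition seg :: "(real \<times> real \<Rightarrow> 'a) \<Rightarrow> real \<times> real \<Rightarrow> real \<times> real \<Rightarrow> (nat \<Rightarrow> real) \<Rightarrow> 'a" where
  "seg G a b = restrict (\<lambda>x. G (x 0 *\<^sub>R a + x 1 *\<^sub>R b)) (standard_simplex 1)"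

lemma seg_cong:
  assumes "\<And>t. \<lbrakk>0 \<le> t; t \<le> 1\<rbrakk> \<Longrightarrow> G ((1 - t) *\<^sub>R a + t *\<^sub>R b) = G' ((1 - t) *\<^sub>R a' + t *\<^sub>R b')"
  shows "seg G a b = seg G' a' b'"
  unfolding seg_def
proof (rule restrict_ext)
  fix x :: "nat \<Rightarrow> real"
  assume "x \<in> standard_simplex 1"
  then have "0 \<le> x 1" "x 1 \<le> 1" "x 0 = 1 - x 1"
    by (auto simp: standard_simplex_def simp flip: One_nat_def) (simp add: algebra_simps)
  then show "G (x 0 *\<^sub>R a + x 1 *\<^sub>R b) = G' (x 0 *\<^sub>R a' + x 1 *\<^sub>R b')"
    using assms [of "x 1"] by simp
qed

lemma singular_face_tri:
  "singular_face 2 0 (tri G a b c) = seg G b c"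
  "singular_face 2 1 (tri G a b c) = seg G a c"
  "singular_face 2 2 (tri G a b c) = seg G a b"
proof -
  have *: "simplical_face k x \<in> standard_simplex 2" if "x \<in> standard_simplex 1" "k \<le> 2" for k and x :: "nat \<Rightarrow> real"
    using simplical_face_in_standard_simplex [of 2 k x] that by simp
  show "singular_face 2 0 (tri G a b c) = seg G b c"
    "singular_face 2 1 (tri G a b c) = seg G a c"
    "singular_face 2 2 (tri G a b c) = seg G a b"
    unfolding singular_face_def seg_def
    by (auto intro!: restrict_ext simp: tri_def * simp flip: One_nat_def)
       (auto simp: simplical_face_def)
qed

lemma chain_boundary_tri:
  "chain_boundary 2 (frag_of (tri G a b c)) = frag_of (seg G b c) - frag_of (seg G a c) + frag_of (seg G a b)"
proof -
  have "{..2::nat} = {0, 1, 2}"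
    by auto
  then show ?thesis
    by (simp add: chain_boundary_of singular_face_tri del: One_nat_def)
qed

lemma simplex_map_tri: "simplex_map 2 h (tri G a b c) = tri (h \<circ> G) a b c"
  by (auto simp: simplex_map_def tri_def intro!: restrict_ext)

lemma chain_map_square_chain: "chain_map 2 h (square_chain G) = square_chain (h \<circ> G)"
  by (simp add: square_chain_def chain_map_diff simplex_map_tri)

lemma square_chain_cong:
  assumes "\<And>s t. \<lbrakk>0 \<le> s; s \<le> 1; 0 \<le> t; t \<le> 1\<rbrakk> \<Longrightarrow> G (s, t) = G' (s, t)"
  shows "square_chain G = square_chain G'"
proof -
  have "G (x 1 + x 2, x 2) = G' (x 1 + x 2, x 2) \<and> G (x 2, x 1 + x 2) = G' (x 2, x 1 + x 2)"
    if "x \<in> standard_simplex 2" for x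
    using standard_simplex_2D(1) [OF that, of 0] standard_simplex_2D(1) [OF that, of 1]
      standard_simplex_2D(1) [OF that, of 2] standard_simplex_2D(3) [OF that] assms [of "x 1 + x 2" "x 2"] assms [of "x 2" "x 1 + x 2"]
    by auto
  then show ?thesis
    unfolding square_chain_def tri_def
    by (intro arg_cong2 [where f = minus] arg_cong [where f = frag_of] restrict_ext) auto
qed

lemma singular_chain_square_chain:
  "continuous_map euclidean X G \<Longrightarrow> singular_chain 2 X (square_chain G)"
  unfolding square_chain_def
  by (intro singular_chain_diff) (auto simp: singular_chain_of singular_simplex_tri)

text \<open>The diagonal cancels, and by hypothesis the left and right sides are the same singular
  simplex. The horizontal sides are left open: they are identified for a torus and collapsed for a
  sphere.\<close>

lemma chain_boundary_square_chain:
  assumes "\<And>t. \<lbrakk>0 \<le> t; t \<le> 1\<rbrakk> \<Longrightarrow> G (1, t) = G (0, t)"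
  shows "chain_boundary 2 (square_chain G) = frag_of (seg G (0, 0) (1, 0)) - frag_of (seg G (0, 1) (1, 1))"
proof -
  have "seg G (1, 0) (1, 1) = seg G (0, 0) (0, 1)"
    by (rule seg_cong) (simp add: assms)
  then show ?thesis
    by (simp add: square_chain_def chain_boundary_diff chain_boundary_tri)
qed

lemma singular_relcycle_square_chain:
  assumes "continuous_map euclidean X G"
    and "\<And>t. \<lbrakk>0 \<le> t; t \<le> 1\<rbrakk> \<Longrightarrow> G (1, t) = G (0, t)"
    and "\<And>s. \<lbrakk>0 \<le> s; s \<le> 1\<rbrakk> \<Longrightarrow> G (s, 1) = G (s, 0)"
  shows "singular_relcycle 2 X {} (square_chain G)"
proof -
  have "seg G (0, 0) (1, 0) = seg G (0, 1) (1, 1)"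
    by (rule seg_cong) (simp add: assms)
  then have "chain_boundary 2 (square_chain G) = 0"
    using assms(2) by (simp add: chain_boundary_square_chain)
  then show ?thesis
    using assms(1) by (simp add: singular_cycle singular_chain_square_chain)
qed

section \<open>Tori and spheres as quotients of the square\<close>

text \<open>A continuous surjection from a compact space onto a Hausdorff space is a quotient map,
  so a map that is constant on its fibres descends.\<close>

lemma quotient_of_compact_lift:
  assumes "continuous_map X Y f" "compact_space X" "Hausdorff_space Y" "f ` topspace X = topspace Y"
    and "continuous_map X Z g"
    and "\<And>x y. \<lbrakk>x \<in> topspace X; y \<in> topspace X; f x = f y\<rbrakk> \<Longrightarrow> g x = g y"
  shows "\<exists>h. continuous_map Y Z h \<and> (\<forall>x\<in>topspace X. h (f x) = g x)"
proof (rule quotient_map_lift_exists [OF T1_Spaces.continuous_imp_quotient_map [OF assms(1-4)] assms(5)])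
  fix h
  assume "continuous_map Y Z h" "\<And>x. x \<in> topspace X \<Longrightarrow> h (f x) = g x"
  then show ?thesis by blast
qed (rule assms(6))

lemma cis_2pi_eq_unit_interval:
  assumes "cis (2 * pi * s) = cis (2 * pi * t)" "0 \<le> s" "s \<le> 1" "0 \<le> t" "t \<le> 1"
  shows "s = t \<or> s = 0 \<and> t = 1 \<or> s = 1 \<and> t = 0"
proof -
  have "sin (2 * pi * s) = sin (2 * pi * t) \<and> cos (2 * pi * s) = cos (2 * pi * t)"
    using assms(1) by (simp add: complex_eq_iff)
  then obtain n :: int where "2 * pi * s = 2 * pi * t + 2 * pi * n"
    using sin_cos_eq_iff by blast
  then have "2 * pi * s = 2 * pi * (t + n)"
    by (simp add: algebra_simps)
  then have *: "s = t + n"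
    by simp
  then have "real_of_int n \<le> 1" "-1 \<le> real_of_int n"
    using assms by linarith+
  then have "n = -1 \<or> n = 0 \<or> n = 1"
    by linarith
  then show ?thesis
    using * assms by auto
qed

abbreviation unit_square :: "(real \<times> real) set" where
  "unit_square \<equiv> {0..1} \<times> {0..1}"

lemma continuous_on_torus_param [continuous_intros]: "continuous_on S torus_param"
  unfolding torus_param_def case_prod_unfold by (intro continuous_intros)

lemma torus_param_in_torus: "torus_param y \<in> torus"
  by (simp add: torus_param_def torus_def case_prod_unfold)

lemma torus_param_image: "torus_param ` unit_square = torus"
proof
  show "torus_param ` unit_square \<subseteq> torus"
    using torus_param_in_torus by blast
  have *: "\<exists>s\<in>{0..1}. z = cis (2 * pi * s)" if "cmod z = 1" for z
  proof (intro bexI)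
    show "z = cis (2 * pi * (Arg2pi z / (2 * pi)))"
      using Arg2pi_eq [of z] that by (simp add: cis_conv_exp)
    show "Arg2pi z / (2 * pi) \<in> {0..1}"
      using Arg2pi_ge_0 [of z] Arg2pi_lt_2pi [of z] by auto
  qed
  show "torus \<subseteq> torus_param ` unit_square"
  proof
    fix z
    assume "z \<in> torus"
    then obtain s t where "s \<in> {0..1}" "t \<in> {0..1}" "z = (cis (2 * pi * s), cis (2 * pi * t))"
      using * [of "fst z"] * [of "snd z"] by (auto simp: torus_def)
    then show "z \<in> torus_param ` unit_square"
      by (auto simp: torus_param_def intro!: image_eqI [of _ _ "(s, t)"])
  qed
qed

text \<open>Points of the square with the same image differ only by the identification of opposite
  sides. The arbitrary \<open>G\<close> puts this into the form of the fibre condition for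
  descending a map.\<close>

lemma torus_param_eqD:
  assumes "torus_param (s, t) = torus_param (s', t')"
    and "(s, t) \<in> unit_square" "(s', t') \<in> unit_square"
    and "\<And>t. \<lbrakk>0 \<le> t; t \<le> 1\<rbrakk> \<Longrightarrow> G (1, t) = G (0, t)"
    and "\<And>s. \<lbrakk>0 \<le> s; s \<le> 1\<rbrakk> \<Longrightarrow> G (s, 1) = G (s, 0)"
  shows "G (s, t) = G (s', t')"
proof -
  have "s = s' \<or> s = 0 \<and> s' = 1 \<or> s = 1 \<and> s' = 0" "t = t' \<or> t = 0 \<and> t' = 1 \<or> t = 1 \<and> t' = 0"
    by (rule cis_2pi_eq_unit_interval; use assms(1-3) in \<open>simp add: torus_param_def\<close>)+
  then show ?thesis
    using assms(2-5) by auto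
qed

lemma continuous_map_torus_param: "continuous_map euclidean (top_of_set torus) torus_param"
  using torus_param_in_torus by (auto simp: continuous_map_in_subtopology continuous_intros)

lemma singular_relcycle_torus:
  "singular_relcycle 2 (top_of_set torus) {} (square_chain torus_param)"
  by (rule singular_relcycle_square_chain [OF continuous_map_torus_param]) (simp_all add: torus_param_def)

lemma torus_fundamental_class_eq:
  "torus_fundamental_class = homologous_rel_set 2 (top_of_set torus) {} (square_chain torus_param)"
proof -
  have "tri torus_param (0, 0) (1, 0) (1, 1) = restrict (\<lambda>x. torus_param (x 1 + x 2, x 2)) (standard_simplex 2)"
    "tri torus_param (0, 0) (0, 1) (1, 1) = restrict (\<lambda>x. torus_param (x 2, x 1 + x 2)) (standard_simplex 2)"
    by (auto simp: tri_def intro!: restrict_ext)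
  then show ?thesis
    by (simp add: torus_fundamental_class_def square_chain_def)
qed

lemma hom_induced_torus:
  assumes "continuous_map (top_of_set torus) X w"
  shows "hom_induced 2 (top_of_set torus) {} X {} w torus_fundamental_class
       = homologous_rel_set 2 X {} (square_chain (w \<circ> torus_param))"
  using hom_induced_chain_map [OF assms _ singular_relcycle_torus, of "{}"]
  by (simp add: torus_fundamental_class_eq chain_map_square_chain)

text \<open>Periodicity at each stage \<open>u\<close> makes \<open>H\<close> descend to a homotopy
  of maps from the torus, and homotopic maps agree on
  \<open>torus_fundamental_class\<close>.\<close>

lemma square_chain_homotopic:
  assumes H: "continuous_map (prod_topology (top_of_set {0..1::real}) (top_of_set unit_square)) X H"
    and per: "\<And>u t. \<lbrakk>u \<in> {0..1}; 0 \<le> t; t \<le> 1\<rbrakk> \<Longrightarrow> H (u, 1, t) = H (u, 0, t)"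
      "\<And>u s. \<lbrakk>u \<in> {0..1}; 0 \<le> s; s \<le> 1\<rbrakk> \<Longrightarrow> H (u, s, 1) = H (u, s, 0)"
  shows "homologous_rel_set 2 X {} (square_chain (\<lambda>y. H (0, y)))
       = homologous_rel_set 2 X {} (square_chain (\<lambda>y. H (1, y)))"
proof -
  let ?I = "top_of_set {0..1::real}"
  have "\<exists>h. continuous_map (prod_topology ?I (top_of_set torus)) X h \<and>
      (\<forall>x\<in>topspace (prod_topology ?I (top_of_set unit_square)). h (fst x, torus_param (snd x)) = H x)"
  \<comment> \<open>Applying the quotient argument to the whole product, which is compact, gives
    joint continuity of the descended map in \<open>u\<close> and the torus variable.\<close>
  proof (rule quotient_of_compact_lift [OF _ _ _ _ H])
    show "continuous_map (prod_topology ?I (top_of_set unit_square)) (prod_topology ?I (top_of_set torus))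
        (\<lambda>x. (fst x, torus_param (snd x)))"
      using torus_param_in_torus
      by (auto simp: continuous_map_in_subtopology simp flip: subtopology_Times euclidean_product_topology
          intro!: continuous_intros continuous_on_compose2 [OF continuous_on_torus_param])
    show "compact_space (prod_topology ?I (top_of_set unit_square))"
      by (auto intro!: compact_space_subtopology compact_Times)
    show "Hausdorff_space (prod_topology ?I (top_of_set torus))"
      by (simp add: Hausdorff_space_prod_topology Hausdorff_space_subtopology)
    show "(\<lambda>x. (fst x, torus_param (snd x))) ` topspace (prod_topology ?I (top_of_set unit_square))
        = topspace (prod_topology ?I (top_of_set torus))"
      by (force simp flip: torus_param_image)
    show "H x = H y" if xy: "x \<in> topspace (prod_topology ?I (top_of_set unit_square))"
      "y \<in> topspace (prod_topology ?I (top_of_set unit_square))"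
      "(fst x, torus_param (snd x)) = (fst y, torus_param (snd y))" for x y
    proof -
      obtain u s t s' t' where x: "x = (u, s, t)" and y: "y = (u, s', t')"
        using xy(3) by (metis fst_conv prod.collapse)
      have u: "u \<in> {0..1}" and "(s, t) \<in> unit_square" "(s', t') \<in> unit_square"
        and "torus_param (s, t) = torus_param (s', t')"
        using xy by (simp_all add: x y)
      then show ?thesis
        unfolding x y using torus_param_eqD [where G = "\<lambda>y. H (u, y)", of s t s' t'] per [OF u] by blast
    qed
  qed
  then obtain h where h: "continuous_map (prod_topology ?I (top_of_set torus)) X h"
    and hH: "\<And>x. x \<in> topspace (prod_topology ?I (top_of_set unit_square)) \<Longrightarrow>
      h (fst x, torus_param (snd x)) = H x"
    by blast
  have "homotopic_with (\<lambda>_. True) (top_of_set torus) X (\<lambda>z. h (0, z)) (\<lambda>z. h (1, z))"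
    using h by (auto simp: homotopic_with_def intro!: exI [of _ h])
  then have "hom_induced 2 (top_of_set torus) {} X {} (\<lambda>z. h (0, z)) torus_fundamental_class
      = hom_induced 2 (top_of_set torus) {} X {} (\<lambda>z. h (1, z)) torus_fundamental_class"
    using homology_homotopy_empty by metis
  moreover have "continuous_map (top_of_set torus) X (\<lambda>z. h (u, z))" if "u \<in> {0..1}" for u
    using continuous_map_compose [OF _ h, of "top_of_set torus" "\<lambda>z. (u, z)"] that
    by (simp add: o_def continuous_map_pairwise continuous_intros)
  moreover have "square_chain ((\<lambda>z. h (u, z)) \<circ> torus_param) = square_chain (\<lambda>y. H (u, y))" if "u \<in> {0..1}" for u
    using hH that by (intro square_chain_cong) force
  ultimately show ?thesis
    by (simp add: hom_induced_torus)
qed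

section \<open>The sphere as a quotient of the square\<close>

text \<open>Spherical coordinates with longitude \<open>2 * pi * s\<close> and polar angle
  \<open>pi * t\<close>. Points of \<open>nsphere 2\<close> are sequences that vanish beyond index
  2.\<close>

definition sphere_param :: "real \<times> real \<Rightarrow> nat \<Rightarrow> real" where
  "sphere_param = (\<lambda>(s, t) i. if i = 0 then sin (pi * t) * cos (2 * pi * s)
     else if i = 1 then sin (pi * t) * sin (2 * pi * s) else if i = 2 then cos (pi * t) else 0)"

lemma topspace_nsphere_2:
  "x \<in> topspace (nsphere 2) \<longleftrightarrow> (x 0)\<^sup>2 + (x 1)\<^sup>2 + (x 2)\<^sup>2 = 1 \<and> (\<forall>i>2. x i = 0)"
proof -
  have "{..2::nat} = {0, 1, 2}"
    by auto
  then show ?thesis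
    by (auto simp: nsphere add.assoc simp del: One_nat_def)
qed

lemma sphere_param_in_sphere: "sphere_param y \<in> topspace (nsphere 2)"
proof -
  have "(sin a * cos b)\<^sup>2 + (sin a * sin b)\<^sup>2 + (cos a)\<^sup>2 = 1" for a b :: real
  proof -
    have "(sin a * cos b)\<^sup>2 + (sin a * sin b)\<^sup>2 + (cos a)\<^sup>2
        = (sin a)\<^sup>2 * ((sin b)\<^sup>2 + (cos b)\<^sup>2) + (cos a)\<^sup>2"
      by (simp only: power_mult_distrib distrib_left add.commute)
    then show ?thesis
      by (simp only: sin_cos_squared_add mult_1_right)
  qed
  then show ?thesis
    by (simp add: topspace_nsphere_2 sphere_param_def case_prod_unfold)
qed

lemma continuous_map_sphere_param: "continuous_map euclidean (nsphere 2) sphere_param"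
proof -
  have "continuous_on UNIV (\<lambda>y. sphere_param y i)" for i
    unfolding sphere_param_def case_prod_unfold
    by (cases "i = 0"; cases "i = 1"; cases "i = 2") (auto intro!: continuous_intros)
  moreover have "range sphere_param \<subseteq> {x. (\<Sum>i\<le>2. (x i)\<^sup>2) = 1 \<and> (\<forall>i>2. x i = 0)}"
    using sphere_param_in_sphere by (auto simp: nsphere)
  ultimately show ?thesis
    by (auto simp: nsphere continuous_map_in_subtopology continuous_map_componentwise_UNIV)
qed

lemma sphere_param_image: "sphere_param ` unit_square = topspace (nsphere 2)"
proof
  show "sphere_param ` unit_square \<subseteq> topspace (nsphere 2)"
    using sphere_param_in_sphere by blast
  show "topspace (nsphere 2) \<subseteq> sphere_param ` unit_square"
  proof
    fix x
    assume "x \<in> topspace (nsphere 2)"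
    then have sum1: "(x 0)\<^sup>2 + (x 1)\<^sup>2 + (x 2)\<^sup>2 = 1" and zero: "\<forall>i>2. x i = 0"
      by (auto simp: topspace_nsphere_2)
    then have "(x 2)\<^sup>2 \<le> 1"
      by (smt (verit) zero_le_power2)
    then have x2: "-1 \<le> x 2" "x 2 \<le> 1"
      by (auto simp: abs_square_le_1)
    define t where "t = arccos (x 2) / pi"
    \<comment> \<open>The radius of the circle of latitude through \<open>x\<close>. It vanishes at
      the poles, where the longitude is arbitrary and \<open>s = 0\<close> is taken.\<close>
    define r where "r = sin (pi * t)"
    have t: "0 \<le> t" "t \<le> 1" "cos (pi * t) = x 2"
      using x2 arccos_bounded [of "x 2"] by (auto simp: t_def)
    have r2: "r\<^sup>2 = (x 0)\<^sup>2 + (x 1)\<^sup>2"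
      using sum1 t(3) sin_cos_squared_add [of "pi * t"] by (simp add: r_def)
    obtain s where s: "0 \<le> s" "s \<le> 1" "x 0 = r * cos (2 * pi * s)" "x 1 = r * sin (2 * pi * s)"
    proof (cases "r = 0")
      case True
      then show ?thesis
        using that [of 0] r2 by (simp add: sum_power2_eq_zero_iff)
    next
      case False
      have "(x 0 / r)\<^sup>2 + (x 1 / r)\<^sup>2 = r\<^sup>2 / r\<^sup>2"
        by (simp only: r2 power_divide add_divide_distrib)
      then have "(x 0 / r)\<^sup>2 + (x 1 / r)\<^sup>2 = 1"
        using False by simp
      then obtain \<theta> where \<theta>: "0 \<le> \<theta>" "\<theta> \<le> 2 * pi" "x 0 / r = cos \<theta>" "x 1 / r = sin \<theta>"
        using sincos_total_2pi_le by blast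
      then show ?thesis
        using that [of "\<theta> / (2 * pi)"] False by (simp add: field_simps)
    qed
    have "x = sphere_param (s, t)"
    proof
      fix i :: nat
      show "x i = sphere_param (s, t) i"
        using s t zero by (auto simp: sphere_param_def r_def)
    qed
    then show "x \<in> sphere_param ` unit_square"
      using s t by auto
  qed
qed

text \<open>The polar angle is determined because cosine is injective on the interval from 0 to pi.
  Away from the poles only the seam \<open>s = 0\<close>, \<open>s = 1\<close> is identified; at a
  pole \<open>G\<close> is constant.\<close>

lemma sphere_param_eqD:
  assumes eq: "sphere_param (s, t) = sphere_param (s', t')"
    and sq: "(s, t) \<in> unit_square" "(s', t') \<in> unit_square"
    and sides: "\<And>t. \<lbrakk>0 \<le> t; t \<le> 1\<rbrakk> \<Longrightarrow> G (1, t) = G (0, t)"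
    and ends: "\<And>s. \<lbrakk>0 \<le> s; s \<le> 1\<rbrakk> \<Longrightarrow> G (s, 0) = p \<and> G (s, 1) = q"
  shows "G (s, t) = G (s', t')"
proof -
  have e: "sin (pi * t) * cos (2 * pi * s) = sin (pi * t') * cos (2 * pi * s')"
    "sin (pi * t) * sin (2 * pi * s) = sin (pi * t') * sin (2 * pi * s')"
    "cos (pi * t) = cos (pi * t')"
    using fun_cong [OF eq, of 0] fun_cong [OF eq, of 1] fun_cong [OF eq, of 2]
    by (simp_all add: sphere_param_def)
  have "0 \<le> pi * t" "pi * t \<le> pi" "0 \<le> pi * t'" "pi * t' \<le> pi"
    using sq by (simp_all add: mult_left_le)
  then have "pi * t = pi * t'"
    by (rule cos_inj_pi) (rule e(3))
  then have t: "t' = t"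
    by simp
  show ?thesis
  proof (cases "t = 0 \<or> t = 1")
    case True
    then show ?thesis
      using ends sq t by auto
  next
    case False
    then have "0 < pi * t" "pi * t < pi"
      using sq by simp_all
    then have "sin (pi * t) > 0"
      by (rule sin_gt_zero)
    then have "cis (2 * pi * s) = cis (2 * pi * s')"
      using e t by (auto simp: complex_eq_iff)
    then have "s = s' \<or> s = 0 \<and> s' = 1 \<or> s = 1 \<and> s' = 0"
      by (rule cis_2pi_eq_unit_interval) (use sq in auto)
    then show ?thesis
      using sides sq t by auto
  qed
qed

text \<open>\<open>F\<close> descends along \<open>sphere_param\<close>, but
  \<open>square_chain sphere_param\<close> is not a cycle: its collapsed horizontal sides are
  constant simplices at different poles. Since both poles go to \<open>p\<close>, the corrections
  needed on the sphere cancel in the image.\<close>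

lemma square_chain_factors_through_sphere:
  assumes F: "continuous_map (top_of_set unit_square) X F"
    and sides: "\<And>t. \<lbrakk>0 \<le> t; t \<le> 1\<rbrakk> \<Longrightarrow> F (1, t) = F (0, t)"
    and ends: "\<And>s. \<lbrakk>0 \<le> s; s \<le> 1\<rbrakk> \<Longrightarrow> F (s, 0) = p \<and> F (s, 1) = p"
  obtains h z where "continuous_map (nsphere 2) X h" "singular_relcycle 2 (nsphere 2) {} z"
    "chain_map 2 h z = square_chain F"
proof -
  have "\<exists>h. continuous_map (nsphere 2) X h \<and>
      (\<forall>y\<in>topspace (top_of_set unit_square). h (sphere_param y) = F y)"
  proof (rule quotient_of_compact_lift [OF _ _ _ _ F])
    show "continuous_map (top_of_set unit_square) (nsphere 2) sphere_param"
      by (intro continuous_map_from_subtopology continuous_map_sphere_param)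
    show "compact_space (top_of_set unit_square)"
      by (auto intro!: compact_space_subtopology compact_Times)
    show "Hausdorff_space (nsphere 2)"
      by (simp add: nsphere Hausdorff_space_subtopology Hausdorff_space_product_topology)
    show "sphere_param ` topspace (top_of_set unit_square) = topspace (nsphere 2)"
      by (simp add: sphere_param_image)
    show "F x = F y" if xy: "x \<in> topspace (top_of_set unit_square)" "y \<in> topspace (top_of_set unit_square)"
      "sphere_param x = sphere_param y" for x y
      using xy sides ends sphere_param_eqD [of "fst x" "snd x" "fst y" "snd y" F p p] by simp
  qed
  then obtain h where h: "continuous_map (nsphere 2) X h"
    and hF: "\<And>y. y \<in> unit_square \<Longrightarrow> h (sphere_param y) = F y"
    by auto
  let ?N = "tri sphere_param (0, 0) (0, 0) (0, 0)" and ?S = "tri sphere_param (0, 1) (0, 1) (0, 1)"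
  \<comment> \<open>The constant simplices cancel the two collapsed edges in the boundary; \<open>h\<close> maps both to the
    same simplex, so they leave no trace in the image.\<close>
  define z where "z = square_chain sphere_param - frag_of ?N + frag_of ?S"
  have "seg sphere_param (0, 0) (1, 0) = seg sphere_param (0, 0) (0, 0)"
    "seg sphere_param (0, 1) (1, 1) = seg sphere_param (0, 1) (0, 1)"
    by (rule seg_cong; auto simp: sphere_param_def)+
  moreover have "sphere_param (1, t) = sphere_param (0, t)" for t
    by (auto simp: sphere_param_def fun_eq_iff)
  ultimately have "chain_boundary 2 z = 0"
    by (simp add: z_def chain_boundary_add chain_boundary_diff chain_boundary_square_chain chain_boundary_tri)
  moreover have "singular_chain 2 (nsphere 2) z"
    unfolding z_def using continuous_map_sphere_param
    by (intro singular_chain_add singular_chain_diff singular_chain_square_chain)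
       (auto simp: singular_chain_of singular_simplex_tri)
  ultimately have "singular_relcycle 2 (nsphere 2) {} z"
    by (simp add: singular_cycle)
  moreover have "chain_map 2 h z = square_chain F"
  proof -
    have "tri (h \<circ> sphere_param) (0, 0) (0, 0) (0, 0) = tri (h \<circ> sphere_param) (0, 1) (0, 1) (0, 1)"
      unfolding tri_def
    proof (rule restrict_ext)
      fix x :: "nat \<Rightarrow> real"
      assume "x \<in> standard_simplex 2"
      from standard_simplex_2D(3) [OF this]
      show "(h \<circ> sphere_param) (x 0 *\<^sub>R (0, 0) + x 1 *\<^sub>R (0, 0) + x 2 *\<^sub>R (0, 0))
        = (h \<circ> sphere_param) (x 0 *\<^sub>R (0, 1) + x 1 *\<^sub>R (0, 1) + x 2 *\<^sub>R (0, 1))"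
        using ends [of 0] by (simp add: hF)
    qed
    moreover have "square_chain (h \<circ> sphere_param) = square_chain F"
      by (rule square_chain_cong) (simp add: hF)
    ultimately show ?thesis
      by (simp add: z_def chain_map_add chain_map_diff chain_map_square_chain simplex_map_tri)
  qed
  ultimately show ?thesis
    using that h by blast
qed

text \<open>Gluing a nullhomotopy of the bottom (hence also of the top) loop to both ends of the cylinder
  does not change the class: shrinking the caps is a homotopy through tori.\<close>

lemma null_loop_square_chain_spherical:
  fixes F :: "real \<times> real \<Rightarrow> 'a::topological_space"
  assumes F: "continuous_on unit_square F" "F ` unit_square \<subseteq> M"
    and sides: "\<And>t. \<lbrakk>0 \<le> t; t \<le> 1\<rbrakk> \<Longrightarrow> F (1, t) = F (0, t)"
    and ends: "\<And>s. \<lbrakk>0 \<le> s; s \<le> 1\<rbrakk> \<Longrightarrow> F (s, 1) = F (s, 0)"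
    and null: "homotopic_loops M (\<lambda>s. F (s, 0)) (\<lambda>_. p)"
  obtains h z where "continuous_map (nsphere 2) (top_of_set M) h" "singular_relcycle 2 (nsphere 2) {} z"
    "homologous_rel_set 2 (top_of_set M) {} (square_chain F)
       = homologous_rel_set 2 (top_of_set M) {} (chain_map 2 h z)"
proof -
  obtain K where K: "continuous_on unit_square K" "K \<in> unit_square \<rightarrow> M"
    and K01: "\<And>s. s \<in> {0..1} \<Longrightarrow> K (0, s) = F (s, 0)" "\<And>s. s \<in> {0..1} \<Longrightarrow> K (1, s) = p"
    and K_loop: "\<And>u. u \<in> {0..1} \<Longrightarrow> K (u, 1) = K (u, 0)"
    using null unfolding homotopic_loops by (auto simp: pathstart_def pathfinish_def)
  \<comment> \<open>The cylinder extended to heights from -1 to 2. Below 0 and above 1 the loops run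
    through the nullhomotopy \<open>K\<close>, ending at the constant loop \<open>p\<close>.\<close>
  define P where "P = (\<lambda>y. if snd y \<le> 0 then K (- snd y, fst y)
     else if snd y \<le> 1 then F y else K (snd y - 1, fst y))"
  let ?D = "{0..1::real} \<times> {-1..2::real}"
  have "continuous_on ?D P"
    unfolding P_def
  proof (intro continuous_on_cases_le)
    show "continuous_on {y \<in> ?D. snd y \<le> 0} (\<lambda>y. K (- snd y, fst y))"
      by (intro continuous_on_compose2 [OF K(1)] continuous_intros) auto
    show "continuous_on {t \<in> {y \<in> ?D. 0 \<le> snd y}. snd t \<le> 1} F"
      by (rule continuous_on_subset [OF F(1)]) auto
    show "continuous_on {t \<in> {y \<in> ?D. 0 \<le> snd y}. 1 \<le> snd t} (\<lambda>y. K (snd y - 1, fst y))"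
      by (intro continuous_on_compose2 [OF K(1)] continuous_intros) auto
  qed (auto intro!: continuous_intros simp: K01 ends)
  moreover have PM: "P y \<in> M" if "y \<in> ?D" for y
  proof -
    have "(- snd y, fst y) \<in> unit_square" if "snd y \<le> 0"
      using \<open>y \<in> ?D\<close> that by auto
    moreover have "y \<in> unit_square" if "0 < snd y" "snd y \<le> 1"
      using \<open>y \<in> ?D\<close> that by (cases y) auto
    moreover have "(snd y - 1, fst y) \<in> unit_square" if "1 < snd y"
      using \<open>y \<in> ?D\<close> that by auto
    ultimately show ?thesis
      using K(2) F(2) unfolding P_def by (smt (verit, ccfv_SIG) PiE image_subset_iff)
  qed
  ultimately have P: "continuous_on ?D P" "P ` ?D \<subseteq> M"
    by auto
  \<comment> \<open>At stage \<open>u\<close> the height runs affinely from \<open>- u\<close> to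
    \<open>1 + u\<close>: stage 0 is \<open>F\<close>, stage 1 is all of \<open>P\<close>.\<close>
  define H where "H = (\<lambda>(u, s, t). P (s, (1 + 2 * u) * t - u))"
  have rng: "(s, (1 + 2 * u) * t - u) \<in> ?D" if "(u, s, t) \<in> {0..1} \<times> unit_square" for u s t
  proof -
    define k where "k = (1 + 2 * u) * t"
    have "0 \<le> k"
      unfolding k_def using that by (intro mult_nonneg_nonneg) auto
    moreover have "k \<le> (1 + 2 * u) * 1"
      unfolding k_def using that by (intro mult_left_mono) auto
    ultimately show ?thesis
      using that by (simp flip: k_def)
  qed
  have "continuous_on ({0..1} \<times> unit_square) H"
    unfolding H_def case_prod_unfold
    by (intro continuous_on_compose2 [OF P(1)] continuous_intros) (use rng in auto)
  moreover have "H ` ({0..1} \<times> unit_square) \<subseteq> M"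
    using P(2) rng by (auto simp: H_def)
  ultimately have H: "continuous_map (top_of_set ({0..1} \<times> unit_square)) (top_of_set M) H"
    by (simp add: image_subset_iff_funcset)
  have P_sides: "P (1, t) = P (0, t)" if "t \<in> {-1..2}" for t
    using that sides K_loop by (auto simp: P_def)
  have P_ends: "P (s, - u) = K (u, s)" "P (s, 1 + u) = K (u, s)" if "s \<in> {0..1}" "u \<in> {0..1}" for s u
    using that K01 ends by (auto simp: P_def)
  have H_sides: "H (u, 1, t) = H (u, 0, t)" if "u \<in> {0..1}" "0 \<le> t" "t \<le> 1" for u t
    using P_sides rng [of u 0 t] that by (simp add: H_def)
  \<comment> \<open>Both ends of the truncated cylinder are the same loop of the nullhomotopy, so
    each stage is a torus, and at stage 1 both ends are constant.\<close>
  have H_ends: "H (u, s, 1) = K (u, s)" "H (u, s, 0) = K (u, s)" if "u \<in> {0..1}" "0 \<le> s" "s \<le> 1" for u s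
    using P_ends [of s u] that by (simp_all add: H_def add.commute)
  have "homologous_rel_set 2 (top_of_set M) {} (square_chain (\<lambda>y. H (0, y)))
      = homologous_rel_set 2 (top_of_set M) {} (square_chain (\<lambda>y. H (1, y)))"
    using H H_sides H_ends by (intro square_chain_homotopic) auto
  moreover have "square_chain (\<lambda>y. H (0, y)) = square_chain F"
    by (rule square_chain_cong) (auto simp: H_def P_def K01)
  moreover obtain h z where "continuous_map (nsphere 2) (top_of_set M) h" "singular_relcycle 2 (nsphere 2) {} z"
    "chain_map 2 h z = square_chain (\<lambda>y. H (1, y))"
  proof (rule square_chain_factors_through_sphere)
    have "continuous_map (top_of_set unit_square) (top_of_set ({0..1} \<times> unit_square)) (\<lambda>y. (1::real, y))"
      by (auto intro!: continuous_intros)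
    from continuous_map_compose [OF this H]
    show "continuous_map (top_of_set unit_square) (top_of_set M) (\<lambda>y. H (1, y))"
      by (simp add: o_def)
    show "H (1, 1, t) = H (1, 0, t)" if "0 \<le> t" "t \<le> 1" for t
      using that by (intro H_sides) auto
    show "H (1, s, 0) = p \<and> H (1, s, 1) = p" if "0 \<le> s" "s \<le> 1" for s
      using that by (simp add: H_ends K01)
  qed
  ultimately show ?thesis
    using that by metis
qed

section \<open>The fundamental group\<close>

text \<open>The straight-line homotopy in \<open>C\<close> is pushed forward by \<open>P\<close>.
  With \<open>C\<close> an interval this yields the laws for reparametrised paths, with
  \<open>C\<close> the plane the addition law for lattice loops.\<close>

lemma homotopic_paths_compose_convex:
  fixes P :: "'b::real_normed_vector \<Rightarrow> 'a::topological_space"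
  assumes P: "continuous_on C P" "P ` C \<subseteq> S" and C: "convex C"
    and f: "path f" "path_image f \<subseteq> C" and g: "path g" "path_image g \<subseteq> C"
    and ends: "pathstart g = pathstart f" "pathfinish g = pathfinish f"
  shows "homotopic_paths S (P \<circ> f) (P \<circ> g)"
proof (rule homotopic_paths_continuous_image)
  have "closed_segment (f t) (g t) \<subseteq> C" if "t \<in> {0..1}" for t
    using f g that C by (intro closed_segment_subset) (auto simp: path_image_def)
  then show "homotopic_paths C f g"
    using f g ends by (intro homotopic_paths_linear) auto
qed (use P in auto)

lemma path_id: "path (id :: real \<Rightarrow> real)" "path_image (id :: real \<Rightarrow> real) = {0..1}"
  "pathstart (id :: real \<Rightarrow> real) = 0" "pathfinish (id :: real \<Rightarrow> real) = 1"
  by (auto simp: path_def path_image_def pathstart_def pathfinish_def continuous_on_id)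

lemma path_const: "path (\<lambda>_. a)" "path_image (\<lambda>_::real. a) = {a}"
  "pathstart (\<lambda>_. a) = a" "pathfinish (\<lambda>_. a) = a"
  by (auto simp: path_def path_image_def pathstart_def pathfinish_def)

text \<open>The library states the unit and inverse laws for normed spaces only.\<close>

lemma homotopic_paths_const_left:
  assumes "path p" "path_image p \<subseteq> S" "a = pathstart p"
  shows "homotopic_paths S ((\<lambda>_. a) +++ p) p"
proof -
  have "homotopic_paths S (p \<circ> ((\<lambda>_. 0) +++ id)) (p \<circ> id)"
    by (rule homotopic_paths_compose_convex [where C = "{0..1}"])
       (use assms in \<open>auto simp: path_def [of p] path_image_def [of p] path_id path_const path_image_join\<close>)
  moreover have "p \<circ> (\<lambda>_::real. 0) = (\<lambda>_. a)"
    using assms by (auto simp: pathstart_def)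
  ultimately show ?thesis
    by (simp only: path_compose_join comp_id)
qed

lemma homotopic_paths_reverse_left:
  assumes "path p" "path_image p \<subseteq> S" "a = pathfinish p"
  shows "homotopic_paths S (reversepath p +++ p) (\<lambda>_. a)"
proof -
  have "homotopic_paths S (p \<circ> (reversepath id +++ id)) (p \<circ> (\<lambda>_. 1))"
    by (rule homotopic_paths_compose_convex [where C = "{0..1}"])
       (use assms in \<open>auto simp: path_def [of p] path_image_def [of p] path_id path_const path_image_join\<close>)
  moreover have "p \<circ> (\<lambda>_::real. 1) = (\<lambda>_. a)" "p \<circ> reversepath id = reversepath p"
    using assms by (auto simp: pathfinish_def reversepath_def)
  ultimately show ?thesis
    by (simp only: path_compose_join comp_id)
qed

lemma homotopic_paths_reverse_cancel:
  assumes "path p" "path_image p \<subseteq> S" "path q" "path_image q \<subseteq> S" "pathstart q = pathfinish p"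
  shows "homotopic_paths S (reversepath p +++ (p +++ q)) q"
proof -
  have "homotopic_paths S (reversepath p +++ (p +++ q)) ((reversepath p +++ p) +++ q)"
    using assms by (intro homotopic_paths_assoc) auto
  also have "homotopic_paths S \<dots> ((\<lambda>_. pathfinish p) +++ q)"
    using assms by (intro homotopic_paths_join homotopic_paths_reverse_left) auto
  also have "homotopic_paths S \<dots> q"
    using assms by (intro homotopic_paths_const_left) auto
  finally show ?thesis .
qed

text \<open>Change of base point along \<open>c\<close> is multiplicative: after reassociation the
  inner \<open>reversepath c\<close> and \<open>c\<close> cancel.\<close>

lemma homotopic_paths_conjugate_join:
  assumes c: "path c" "path_image c \<subseteq> S"
    and p: "path p" "path_image p \<subseteq> S" "pathstart p = pathfinish c" "pathfinish p = pathfinish c"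
    and q: "path q" "path_image q \<subseteq> S" "pathstart q = pathfinish c" "pathfinish q = pathfinish c"
    and r: "homotopic_paths S (p +++ q) r"
  shows "homotopic_paths S ((c +++ (p +++ reversepath c)) +++ (c +++ (q +++ reversepath c)))
                           (c +++ (r +++ reversepath c))"
proof -
  let ?c = "reversepath c"
  have "homotopic_paths S ((c +++ (p +++ ?c)) +++ (c +++ (q +++ ?c))) (c +++ ((p +++ ?c) +++ (c +++ (q +++ ?c))))"
    using c p q by (intro homotopic_paths_sym [OF homotopic_paths_assoc]) (auto simp: path_image_join)
  also have "homotopic_paths S \<dots> (c +++ (p +++ (?c +++ (c +++ (q +++ ?c)))))"
    using c p q
    by (intro homotopic_paths_join homotopic_paths_sym [OF homotopic_paths_assoc]) (auto simp: path_image_join)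
  also have "homotopic_paths S \<dots> (c +++ (p +++ (q +++ ?c)))"
    using c p q
    by (intro homotopic_paths_join homotopic_paths_reverse_cancel) (auto simp: path_image_join)
  also have "homotopic_paths S \<dots> (c +++ ((p +++ q) +++ ?c))"
    using c p q
    by (intro homotopic_paths_join homotopic_paths_assoc) (auto simp: path_image_join)
  also have "homotopic_paths S \<dots> (c +++ (r +++ ?c))"
    using c p q r by (intro homotopic_paths_join r) (auto simp: path_image_join)
  finally show ?thesis .
qed

text \<open>Shrinking the domain of the conjugate from both ends leaves a loop at every stage.\<close>

lemma homotopic_loops_conjugate_top:
  assumes c: "path c" "path_image c \<subseteq> S"
    and q: "path q" "path_image q \<subseteq> S" "pathstart q = pathfinish c" "pathfinish q = pathfinish c"
  shows "homotopic_loops S (c +++ (q +++ reversepath c)) q"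
proof -
  define r where "r = c +++ (q +++ reversepath c)"
  have "path r" "path_image r \<subseteq> S"
    using c q by (auto simp: r_def path_image_join)
  then have r: "continuous_on {0..1} r" "r ` {0..1} \<subseteq> S"
    by (auto simp: path_def path_image_def)
  \<comment> \<open>Stage \<open>u\<close> traverses \<open>r\<close> from \<open>u / 2\<close> to
    \<open>1 - u / 4\<close>, and both end points are mapped to \<open>c u\<close>. As
    \<open>+++\<close> halves the interval twice, \<open>q\<close> occupies the part of
    \<open>r\<close> from 1/2 to 3/4, which is stage 1.\<close>
  define h where "h = (\<lambda>(u, t). r (u / 2 + t * (1 - 3 * u / 4)))"
  have *: "u / 2 + t * (1 - 3 * u / 4) \<in> {0..1}" if "u \<in> {0..1}" "t \<in> {0..1}" for u t :: real
  proof -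
    define k where "k = t * (1 - 3 * u / 4)"
    have "0 \<le> k"
      unfolding k_def using that by (intro mult_nonneg_nonneg) auto
    moreover have "k \<le> 1 * (1 - 3 * u / 4)"
      unfolding k_def using that by (intro mult_right_mono) auto
    ultimately show ?thesis
      using that by (simp flip: k_def)
  qed
  have "continuous_on ({0..1} \<times> {0..1}) h"
    unfolding h_def case_prod_unfold
    by (intro continuous_on_compose2 [OF r(1)] continuous_intros) (use * in auto)
  moreover have "h \<in> {0..1} \<times> {0..1} \<rightarrow> S"
    using r(2) * by (auto simp: h_def)
  moreover have "h (0, t) = r t" for t
    by (simp add: h_def)
  moreover have "h (1, t) = q t" if "t \<in> {0..1}" for t
  proof (cases "t = 0")
    case True
    then show ?thesis
      using q by (simp add: h_def r_def joinpaths_def pathstart_def pathfinish_def)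
  next
    case False
    then show ?thesis
      using that by (auto simp: h_def r_def joinpaths_def field_simps)
  qed
  moreover have "h (u, 0) = c u" "h (u, 1) = c u" if "u \<in> {0..1}" for u
  proof -
    show "h (u, 0) = c u"
      using that by (simp add: h_def r_def joinpaths_def)
    have "h (u, 1) = r (1 - u / 4)"
      by (simp add: h_def algebra_simps)
    also have "\<dots> = c u"
    proof (cases "u = 1")
      case True
      then show ?thesis
        using q by (simp add: r_def joinpaths_def pathfinish_def)
    next
      case False
      then show ?thesis
        using that by (auto simp: r_def joinpaths_def reversepath_def field_simps)
    qed
    finally show "h (u, 1) = c u" .
  qed
  ultimately show ?thesis
    unfolding homotopic_loops r_def [symmetric]
    by (intro exI [of _ h]) (auto simp: pathstart_def pathfinish_def)
qed

section \<open>Based loops and the group structure on their classes\<close>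

context
  fixes M :: "'a::topological_space set" and x0 :: 'a
begin

definition based_loops :: "(real \<Rightarrow> 'a) set" where
  "based_loops = {p. path p \<and> path_image p \<subseteq> M \<and> pathstart p = x0 \<and> pathfinish p = x0}"

definition loop_class :: "(real \<Rightarrow> 'a) \<Rightarrow> (real \<Rightarrow> 'a) set" where
  "loop_class p = based_homotopy M x0 `` {p}"

lemma loop_class_eq_iff:
  assumes "p \<in> based_loops"
  shows "loop_class p = loop_class q \<longleftrightarrow> homotopic_paths M p q"
proof
  assume "loop_class p = loop_class q"
  moreover have "p \<in> loop_class p"
    using assms by (simp add: loop_class_def based_homotopy_def based_loops_def)
  ultimately have "p \<in> loop_class q"
    by simp
  then show "homotopic_paths M p q"
    by (auto simp: loop_class_def based_homotopy_def intro: homotopic_paths_sym)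
next
  assume pq: "homotopic_paths M p q"
  then have "pathstart q = x0" "pathfinish q = x0"
    using assms homotopic_paths_imp_pathstart homotopic_paths_imp_pathfinish
    by (fastforce simp: based_loops_def)+
  then show "loop_class p = loop_class q"
    using assms pq
    by (auto simp: loop_class_def based_homotopy_def based_loops_def
        intro: homotopic_paths_trans homotopic_paths_sym)
qed

lemma carrier_fundamental_group: "carrier (fundamental_group M x0) = loop_class ` based_loops"
  by (auto simp: fundamental_group_def quotient_def loop_class_def based_loops_def)

lemma one_fundamental_group: "\<one>\<^bsub>fundamental_group M x0\<^esub> = loop_class (\<lambda>_. x0)"
  by (simp add: fundamental_group_def loop_class_def)

lemma in_loop_classD:
  assumes "p' \<in> loop_class p" "p \<in> based_loops"
  shows "p' \<in> based_loops" "homotopic_paths M p p'"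
proof -
  show hom: "homotopic_paths M p p'"
    using assms by (simp add: loop_class_def based_homotopy_def)
  show "p' \<in> based_loops"
    using assms(2) homotopic_paths_imp_path [OF hom] homotopic_paths_imp_subset [OF hom]
      homotopic_paths_imp_pathstart [OF hom] homotopic_paths_imp_pathfinish [OF hom]
    by (simp add: based_loops_def)
qed

lemma join_based_loops: "\<lbrakk>p \<in> based_loops; q \<in> based_loops\<rbrakk> \<Longrightarrow> p +++ q \<in> based_loops"
  by (auto simp: based_loops_def path_image_join)

text \<open>The union over all representatives in the definition of the product collapses to one
  class, because joining respects homotopy.\<close>

lemma mult_fundamental_group:
  assumes "p \<in> based_loops" "q \<in> based_loops"
  shows "loop_class p \<otimes>\<^bsub>fundamental_group M x0\<^esub> loop_class q = loop_class (p +++ q)"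
proof -
  have "loop_class (p' +++ q') = loop_class (p +++ q)" if "p' \<in> loop_class p" "q' \<in> loop_class q" for p' q'
  proof -
    have "homotopic_paths M (p +++ q) (p' +++ q')"
      using that assms in_loop_classD(2) by (intro homotopic_paths_join) (auto simp: based_loops_def)
    then show ?thesis
      using loop_class_eq_iff [OF join_based_loops [OF assms]] by metis
  qed
  moreover have "p \<in> loop_class p" "q \<in> loop_class q"
    using assms by (simp_all add: loop_class_def based_homotopy_def based_loops_def)
  ultimately have "(\<Union>p'\<in>loop_class p. \<Union>q'\<in>loop_class q. loop_class (p' +++ q')) = loop_class (p +++ q)"
    by blast
  then show ?thesis
    by (simp add: fundamental_group_def loop_class_def)
qed

lemma group_fundamental_group:
  assumes "x0 \<in> M"
  shows "group (fundamental_group M x0)"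
proof (rule groupI)
  let ?G = "fundamental_group M x0"
  have const: "(\<lambda>_. x0) \<in> based_loops"
    using assms by (simp add: based_loops_def path_const)
  show "\<one>\<^bsub>?G\<^esub> \<in> carrier ?G"
    using const by (simp add: one_fundamental_group carrier_fundamental_group)
  show "x \<otimes>\<^bsub>?G\<^esub> y \<in> carrier ?G" if "x \<in> carrier ?G" "y \<in> carrier ?G" for x y
    using that by (auto simp: carrier_fundamental_group mult_fundamental_group join_based_loops)
  show "x \<otimes>\<^bsub>?G\<^esub> y \<otimes>\<^bsub>?G\<^esub> z = x \<otimes>\<^bsub>?G\<^esub> (y \<otimes>\<^bsub>?G\<^esub> z)"
    if xyz: "x \<in> carrier ?G" "y \<in> carrier ?G" "z \<in> carrier ?G" for x y z
  proof -
    obtain p q r where pqr: "p \<in> based_loops" "q \<in> based_loops" "r \<in> based_loops"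
      and x: "x = loop_class p" "y = loop_class q" "z = loop_class r"
      using xyz by (auto simp: carrier_fundamental_group)
    have "homotopic_paths M (p +++ (q +++ r)) ((p +++ q) +++ r)"
      using pqr by (intro homotopic_paths_assoc) (auto simp: based_loops_def)
    then have "loop_class (p +++ (q +++ r)) = loop_class ((p +++ q) +++ r)"
      using loop_class_eq_iff join_based_loops pqr by blast
    then show ?thesis
      using pqr by (simp add: x mult_fundamental_group join_based_loops)
  qed
  show "\<one>\<^bsub>?G\<^esub> \<otimes>\<^bsub>?G\<^esub> x = x" if x: "x \<in> carrier ?G" for x
  proof -
    obtain p where p: "p \<in> based_loops" "x = loop_class p"
      using x by (auto simp: carrier_fundamental_group)
    then have "homotopic_paths M ((\<lambda>_. x0) +++ p) p"
      by (intro homotopic_paths_const_left) (auto simp: based_loops_def)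
    then show ?thesis
      using p const loop_class_eq_iff [OF join_based_loops [OF const p(1)]]
      by (simp add: one_fundamental_group mult_fundamental_group)
  qed
  show "\<exists>y\<in>carrier ?G. y \<otimes>\<^bsub>?G\<^esub> x = \<one>\<^bsub>?G\<^esub>" if x: "x \<in> carrier ?G" for x
  proof -
    obtain p where p: "p \<in> based_loops" "x = loop_class p"
      using x by (auto simp: carrier_fundamental_group)
    have rev: "reversepath p \<in> based_loops"
      using p by (auto simp: based_loops_def)
    have "homotopic_paths M (reversepath p +++ p) (\<lambda>_. x0)"
      using p by (intro homotopic_paths_reverse_left) (auto simp: based_loops_def)
    then have "loop_class (reversepath p) \<otimes>\<^bsub>?G\<^esub> x = \<one>\<^bsub>?G\<^esub>"
      using p rev loop_class_eq_iff [OF join_based_loops [OF rev p(1)]]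
      by (simp add: one_fundamental_group mult_fundamental_group)
    then show ?thesis
      using rev by (auto simp: carrier_fundamental_group)
  qed
qed

text \<open>Conjugation by \<open>c\<close> moves the lattice loops from \<open>G (0, 0)\<close> to
  the base point \<open>x0\<close>, where the hypothesis on the group applies. A free homotopy then
  removes the conjugation again.\<close>

lemma torus_loop_null_homotopic:
  fixes G :: "real \<times> real \<Rightarrow> 'a"
  assumes c: "path c" "path_image c \<subseteq> M" "pathstart c = x0" "pathfinish c = G (0, 0)"
    and G: "continuous_on UNIV G" "range G \<subseteq> M"
    and per: "\<And>y i j. G (y + (of_int i, of_int j)) = G y"
    and no_Z2: "\<not> (\<exists>H. subgroup H (fundamental_group M x0) \<and>
                (fundamental_group M x0)\<lparr>carrier := H\<rparr> \<cong> integer_group \<times>\<times> integer_group)"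
  obtains m n :: int where "(m, n) \<noteq> (0, 0)"
    "homotopic_loops M (\<lambda>t. G (t *\<^sub>R (of_int m, of_int n))) (\<lambda>_. x0)"
proof -
  let ?G = "fundamental_group M x0"
  define \<iota> :: "int \<times> int \<Rightarrow> real \<times> real" where "\<iota> v = (of_int (fst v), of_int (snd v))" for v
  define \<gamma> where "\<gamma> v t = G (t *\<^sub>R \<iota> v)" for v and t :: real
  define \<delta> where "\<delta> v = c +++ (\<gamma> v +++ reversepath c)" for v
  have G_\<iota>: "G (\<iota> v + y) = G y" "G (\<iota> v) = G (0, 0)" for v y
    using per [of y "fst v" "snd v"] per [of "(0, 0)" "fst v" "snd v"] by (simp_all add: \<iota>_def add.commute)
  have \<gamma>: "path (\<gamma> v)" "path_image (\<gamma> v) \<subseteq> M" "pathstart (\<gamma> v) = pathfinish c" "pathfinish (\<gamma> v) = pathfinish c" for v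
  proof -
    have "continuous_on {0..1} (\<gamma> v)"
      unfolding \<gamma>_def [abs_def] by (intro continuous_on_compose2 [OF G(1)] continuous_intros) auto
    then show "path (\<gamma> v)"
      by (simp add: path_def)
    show "path_image (\<gamma> v) \<subseteq> M"
      using G by (auto simp: path_image_def \<gamma>_def)
    show "pathstart (\<gamma> v) = pathfinish c" "pathfinish (\<gamma> v) = pathfinish c"
      using c G_\<iota>(2) [of v] by (auto simp: pathstart_def pathfinish_def \<gamma>_def zero_prod_def)
  qed
  have \<gamma>_add: "homotopic_paths M (\<gamma> u +++ \<gamma> v) (\<gamma> (u + v))" for u v
  proof -
    \<comment> \<open>In the plane the broken line through \<open>\<iota> u\<close> deforms to the
      direct segment. By periodicity \<open>G\<close> maps its second piece to
      \<open>\<gamma> v\<close>.\<close>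
    have "homotopic_paths M (G \<circ> (linepath 0 (\<iota> u) +++ linepath (\<iota> u) (\<iota> (u + v)))) (G \<circ> linepath 0 (\<iota> (u + v)))"
      using G by (intro homotopic_paths_compose_convex [where C = UNIV]) auto
    moreover have "G \<circ> linepath 0 (\<iota> w) = \<gamma> w" for w
      by (auto simp: linepath_def \<gamma>_def)
    moreover have "G \<circ> linepath (\<iota> u) (\<iota> (u + v)) = \<gamma> v"
    proof
      fix t
      have "linepath (\<iota> u) (\<iota> (u + v)) t = \<iota> u + t *\<^sub>R \<iota> v"
        by (simp add: linepath_def \<iota>_def algebra_simps)
      then show "(G \<circ> linepath (\<iota> u) (\<iota> (u + v))) t = \<gamma> v t"
        by (simp add: G_\<iota> \<gamma>_def)
    qed
    ultimately show ?thesis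
      by (simp add: path_compose_join)
  qed
  have \<delta>: "\<delta> v \<in> based_loops" for v
    using c \<gamma> [of v] by (auto simp: \<delta>_def based_loops_def path_image_join)
  define h where "h v = loop_class (\<delta> v)" for v
  have x0: "x0 \<in> M"
    using c by (metis pathstart_in_path_image subsetD)
  have grp: "group ?G" "group (integer_group \<times>\<times> integer_group)"
    using group_fundamental_group [OF x0] by (auto simp: DirProd_group)
  have h_add: "h (u + v) = h u \<otimes>\<^bsub>?G\<^esub> h v" for u v
  proof -
    have "homotopic_paths M (\<delta> u +++ \<delta> v) (\<delta> (u + v))"
      unfolding \<delta>_def using c \<gamma> \<gamma>_add by (intro homotopic_paths_conjugate_join) auto
    then have "loop_class (\<delta> u +++ \<delta> v) = loop_class (\<delta> (u + v))"
      using loop_class_eq_iff [OF join_based_loops [OF \<delta> \<delta>]] by metis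
    then show ?thesis
      by (simp add: h_def mult_fundamental_group \<delta>)
  qed
  have "h \<in> hom (integer_group \<times>\<times> integer_group) ?G"
    using h_add \<delta> by (auto simp: hom_def h_def carrier_fundamental_group integer_group_def)
  then interpret group_hom "integer_group \<times>\<times> integer_group" ?G h
    using grp by (simp add: group_hom_def group_hom_axioms_def)
  \<comment> \<open>An injective \<open>h\<close> would be an isomorphism onto its image, a subgroup
    of the excluded kind. A nontrivial kernel element is the required \<open>(m, n)\<close>.\<close>
  have "\<not> inj_on h (carrier (integer_group \<times>\<times> integer_group))"
  proof
    assume "inj_on h (carrier (integer_group \<times>\<times> integer_group))"
    then have "h \<in> iso (integer_group \<times>\<times> integer_group) (?G\<lparr>carrier := h ` carrier (integer_group \<times>\<times> integer_group)\<rparr>)"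
      using homh by (auto simp: iso_def hom_def bij_betw_def)
    then have "?G\<lparr>carrier := h ` carrier (integer_group \<times>\<times> integer_group)\<rparr> \<cong> integer_group \<times>\<times> integer_group"
      using group.iso_sym [OF grp(2)] is_isoI by blast
    then show False
      using no_Z2 img_is_subgroup by blast
  qed
  then have "kernel (integer_group \<times>\<times> integer_group) ?G h \<noteq> {(0, 0)}"
    by (simp only: inj_iff_trivial_ker) (simp add: DirProd_def)
  moreover have "(0, 0) \<in> kernel (integer_group \<times>\<times> integer_group) ?G h"
    using hom_one by (simp add: kernel_def DirProd_def)
  ultimately obtain v where v: "v \<noteq> (0, 0)" "h v = \<one>\<^bsub>?G\<^esub>"
    by (auto simp: kernel_def)
  then have "homotopic_paths M (\<delta> v) (\<lambda>_. x0)"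
    using loop_class_eq_iff [OF \<delta>] by (simp add: h_def one_fundamental_group)
  then have "homotopic_loops M (\<delta> v) (\<lambda>_. x0)"
    using \<delta> [of v] by (intro homotopic_paths_imp_homotopic_loops) (auto simp: based_loops_def pathfinish_def pathstart_def)
  moreover have "homotopic_loops M (\<gamma> v) (\<delta> v)"
    unfolding \<delta>_def using c \<gamma> by (intro homotopic_loops_sym [OF homotopic_loops_conjugate_top]) auto
  ultimately have "homotopic_loops M (\<gamma> v) (\<lambda>_. x0)"
    by (rule homotopic_loops_trans [rotated])
  then show ?thesis
    using that [of "fst v" "snd v"] v(1) by (auto simp: \<gamma>_def [abs_def] \<iota>_def prod_eq_iff)
qed

end

section \<open>Spherical and toroidal classes\<close>

text \<open>This justifies the choice in \<open>sphere_fundamental_class\<close>: the reduced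
  homology of the sphere is cyclic, and in degree 2 it equals the unreduced one.\<close>

lemma sphere_fundamental_class_generates:
  shows "sphere_fundamental_class \<in> carrier (homology_group 2 (nsphere 2))"
    and "generate (homology_group 2 (nsphere 2)) {sphere_fundamental_class}
       = carrier (homology_group 2 (nsphere 2))"
proof -
  have "cyclic_group (homology_group 2 (nsphere 2))"
    using cyclic_reduced_homology_group_nsphere [of 2 2] by (simp add: un_reduced_homology_group)
  then obtain a where a: "a \<in> carrier (homology_group 2 (nsphere 2))"
    "subgroup_generated (homology_group 2 (nsphere 2)) {a} = homology_group 2 (nsphere 2)"
    by (auto simp: cyclic_group_def)
  then have "generate (homology_group 2 (nsphere 2)) {a} = carrier (homology_group 2 (nsphere 2))"
    using carrier_subgroup_generated [of "homology_group 2 (nsphere 2)" "{a}"] by simp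
  with a(1) have "\<exists>a. a \<in> carrier (homology_group 2 (nsphere 2)) \<and>
      generate (homology_group 2 (nsphere 2)) {a} = carrier (homology_group 2 (nsphere 2))"
    by blast
  from someI_ex [OF this]
  show "sphere_fundamental_class \<in> carrier (homology_group 2 (nsphere 2))"
    and "generate (homology_group 2 (nsphere 2)) {sphere_fundamental_class}
       = carrier (homology_group 2 (nsphere 2))"
    unfolding sphere_fundamental_class_def by auto
qed

section \<open>Group operations of homology on representing cycles\<close>

lemma one_homologous_rel_set:
  "\<one>\<^bsub>relative_homology_group (int p) X S\<^esub> = homologous_rel_set p X S 0"
proof -
  have "homologous_rel_set p X S 0 = singular_relboundary_set p X S"
    by (subst homologous_rel_set_eq_relboundary) simp
  then show ?thesis
    by simp
qed

lemma mult_homologous_rel_set: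
  "homologous_rel_set p X S c \<otimes>\<^bsub>relative_homology_group (int p) X S\<^esub> homologous_rel_set p X S d
     = homologous_rel_set p X S (c + d)"
proof -
  have "\<exists>r s. homologous_rel p X S c r \<and> homologous_rel p X S d s \<and> x = r + s"
    if "homologous_rel p X S (c + d) x" for x
  proof (intro exI conjI)
    show "homologous_rel p X S d (x - c)"
      using homologous_rel_diff [OF that homologous_rel_refl [of p X S c]] by simp
  qed auto
  then show ?thesis
    unfolding mult_relative_homology_group by (auto intro: homologous_rel_add)
qed

lemma inv_homologous_rel_set:
  assumes "singular_relcycle p X S c"
  shows "inv\<^bsub>relative_homology_group (int p) X S\<^esub> (homologous_rel_set p X S c) = homologous_rel_set p X S (- c)"
proof (rule group.inv_equality)
  show "homologous_rel_set p X S (- c) \<otimes>\<^bsub>relative_homology_group (int p) X S\<^esub> homologous_rel_set p X S c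
      = \<one>\<^bsub>relative_homology_group (int p) X S\<^esub>"
    by (simp only: mult_homologous_rel_set one_homologous_rel_set left_minus)
qed (use assms in \<open>simp_all add: carrier_relative_homology_group singular_relcycle_minus\<close>)

text \<open>Proportionality is given on the image of the generator only. Both pairings are additive,
  so it spreads to the images of all classes on the sphere.\<close>

lemma kronecker_proportional_sphere_image:
  fixes \<Phi> :: "('a, real) cochain set" and \<Psi> :: "('a, int) cochain set"
  assumes \<Phi>: "\<Phi> \<in> cohomology 2 X" and \<Psi>: "\<Psi> \<in> cohomology 2 X"
    and h: "continuous_map (nsphere 2) X h"
    and proportional: "kronecker \<Phi> (hom_induced 2 (nsphere 2) {} X {} h sphere_fundamental_class)
      = l * of_int (kronecker \<Psi> (hom_induced 2 (nsphere 2) {} X {} h sphere_fundamental_class))"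
    and z: "singular_relcycle 2 (nsphere 2) {} z"
  shows "kronecker \<Phi> (homologous_rel_set 2 X {} (chain_map 2 h z))
       = l * of_int (kronecker \<Psi> (homologous_rel_set 2 X {} (chain_map 2 h z)))"
proof -
  let ?H = "homology_group 2 (nsphere 2)"
  obtain f g where f: "f \<in> \<Phi>" and g: "g \<in> \<Psi>"
    using cohomology_representative \<Phi> \<Psi> by metis
  have carrier: "carrier ?H = homologous_rel_set 2 (nsphere 2) {} ` singular_relcycle_set 2 (nsphere 2) {}"
    using carrier_relative_homology_group [of 2 "nsphere 2" "{}"] by simp
  have ind: "hom_induced 2 (nsphere 2) {} X {} h (homologous_rel_set 2 (nsphere 2) {} c)
      = homologous_rel_set 2 X {} (chain_map 2 h c)" if "singular_relcycle 2 (nsphere 2) {} c" for c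
    using hom_induced_chain_map [OF h _ that, of "{}"] by simp
  have ev: "kronecker \<Phi> (homologous_rel_set 2 X {} (chain_map 2 h c)) = cochain_eval f (chain_map 2 h c)"
    "kronecker \<Psi> (homologous_rel_set 2 X {} (chain_map 2 h c)) = cochain_eval g (chain_map 2 h c)"
    if "singular_relcycle 2 (nsphere 2) {} c" for c
    using that h \<Phi> \<Psi> f g by (auto intro!: kronecker_cycle singular_relcycle_chain_map)
  obtain c0 where c0: "singular_relcycle 2 (nsphere 2) {} c0"
    "sphere_fundamental_class = homologous_rel_set 2 (nsphere 2) {} c0"
    using sphere_fundamental_class_generates(1) unfolding carrier by blast
  have ev0: "cochain_eval f (chain_map 2 h c0) = l * of_int (cochain_eval g (chain_map 2 h c0))"
    using proportional by (simp add: c0 ind ev)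
  \<comment> \<open>The induction produces some cycle \<open>c\<close> in each class. For the class
    of \<open>z\<close> it may differ from \<open>z\<close>, but the two have homologous images
    under \<open>h\<close>.\<close>
  have "\<exists>c. singular_relcycle 2 (nsphere 2) {} c \<and> x = homologous_rel_set 2 (nsphere 2) {} c \<and>
      cochain_eval f (chain_map 2 h c) = l * of_int (cochain_eval g (chain_map 2 h c))"
    if "x \<in> generate ?H {sphere_fundamental_class}" for x
    using that
  proof (induction rule: generate.induct)
    case one
    have "\<one>\<^bsub>?H\<^esub> = homologous_rel_set 2 (nsphere 2) {} 0"
      using one_homologous_rel_set [of 2 "nsphere 2" "{}"] by simp
    then show ?case
      by (intro exI [of _ 0]) simp
  next
    case (incl a)
    then show ?case
      using c0 ev0 by blast
  next
    case (inv a)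
    have "inv\<^bsub>?H\<^esub> a = homologous_rel_set 2 (nsphere 2) {} (- c0)"
      using inv_homologous_rel_set [of 2, OF c0(1)] inv c0(2) by simp
    then show ?case
      using c0 ev0
      by (intro exI [of _ "- c0"]) (simp add: singular_relcycle_minus chain_map_minus cochain_eval_minus)
  next
    case (eng a b)
    then obtain c d where c: "singular_relcycle 2 (nsphere 2) {} c" "a = homologous_rel_set 2 (nsphere 2) {} c"
      and d: "singular_relcycle 2 (nsphere 2) {} d" "b = homologous_rel_set 2 (nsphere 2) {} d"
      and *: "cochain_eval f (chain_map 2 h c) = l * of_int (cochain_eval g (chain_map 2 h c))"
        "cochain_eval f (chain_map 2 h d) = l * of_int (cochain_eval g (chain_map 2 h d))"
      by blast
    have "a \<otimes>\<^bsub>?H\<^esub> b = homologous_rel_set 2 (nsphere 2) {} (c + d)"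
      using mult_homologous_rel_set [of 2 "nsphere 2" "{}" c d] c d by simp
    then show ?case
      using c d * by (intro exI [of _ "c + d"])
        (simp add: singular_relcycle_add chain_map_add cochain_eval_add distrib_left)
  qed
  moreover have "homologous_rel_set 2 (nsphere 2) {} z \<in> generate ?H {sphere_fundamental_class}"
    unfolding sphere_fundamental_class_generates(2) carrier using z by blast
  ultimately obtain c where c: "singular_relcycle 2 (nsphere 2) {} c"
    "homologous_rel_set 2 (nsphere 2) {} z = homologous_rel_set 2 (nsphere 2) {} c"
    "cochain_eval f (chain_map 2 h c) = l * of_int (cochain_eval g (chain_map 2 h c))"
    by blast
  have "homologous_rel_set 2 X {} (chain_map 2 h z) = homologous_rel_set 2 X {} (chain_map 2 h c)"
    using ind [OF z] ind [OF c(1)] c(2) by simp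
  then show ?thesis
    using ev [OF c(1)] c(3) by simp
qed

lemma torus_param_translate: "torus_param (y + (of_int i, of_int j)) = torus_param y"
proof -
  have "cis (2 * pi * (s + of_int k)) = cis (2 * pi * s)" for s :: real and k :: int
  proof -
    have "sin (2 * pi * (s + of_int k)) = sin (2 * pi * s) \<and> cos (2 * pi * (s + of_int k)) = cos (2 * pi * s)"
      unfolding sin_cos_eq_iff by (intro exI [of _ k]) (simp add: distrib_left)
    then show ?thesis
      by (simp add: complex_eq_iff)
  qed
  then show ?thesis
    by (simp add: torus_param_def case_prod_unfold)
qed

text \<open>Both \<open>square_chain G\<close> and its rotated version are cycles, so the pairings
  are evaluations of one cocycle. The ring is general in order to cover real and integral
  classes.\<close>

lemma kronecker_square_chain_rotation:
  fixes \<Phi> :: "('a, 'r::comm_ring_1) cochain set"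
  assumes \<Phi>: "\<Phi> \<in> cohomology 2 X" and G: "continuous_map euclidean X G"
    and per: "\<And>y i j. G (y + (of_int i, of_int j)) = G y"
  shows "kronecker \<Phi> (homologous_rel_set 2 X {}
           (square_chain (\<lambda>y. G (fst y *\<^sub>R (of_int m, of_int n) + snd y *\<^sub>R (- of_int n, of_int m)))))
       = of_int (m\<^sup>2 + n\<^sup>2) * kronecker \<Phi> (homologous_rel_set 2 X {} (square_chain G))"
proof -
  obtain f where f: "f \<in> \<Phi>" "cocycle 2 X f"
    using cohomology_representative [OF \<Phi>] by blast
  define F where "F y = G (fst y *\<^sub>R (of_int m, of_int n) + snd y *\<^sub>R (- of_int n, of_int m))" for y
  have "continuous_map euclidean euclidean
      (\<lambda>y::real \<times> real. fst y *\<^sub>R (of_int m :: real, of_int n :: real) + snd y *\<^sub>R (- of_int n, of_int m))"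
    by (simp add: continuous_intros)
  from continuous_map_compose [OF this G] have F: "continuous_map euclidean X F"
    by (simp add: o_def F_def [abs_def])
  have "F (1, t) = F (0, t)" for t
    \<comment> \<open>Passing from \<open>s = 0\<close> to \<open>s = 1\<close> translates the
      argument of \<open>G\<close> by the lattice vector \<open>(m, n)\<close>.\<close>
    using per [of "t *\<^sub>R (- of_int n, of_int m)" m n] by (simp add: F_def add.commute)
  moreover have "F (s, 1) = F (s, 0)" for s
    using per [of "s *\<^sub>R (of_int m, of_int n)" "- n" m] by (simp add: F_def)
  ultimately have "kronecker \<Phi> (homologous_rel_set 2 X {} (square_chain F)) = cochain_eval f (square_chain F)"
    using F by (intro kronecker_cycle [OF \<Phi> f(1)] singular_relcycle_square_chain) auto
  also have "\<dots> = of_int (m\<^sup>2 + n\<^sup>2) * cochain_eval f (square_chain G)"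
    unfolding F_def [abs_def] using f(2) G per by (rule cochain_eval_square_chain_rotation)
  also have "cochain_eval f (square_chain G) = kronecker \<Phi> (homologous_rel_set 2 X {} (square_chain G))"
  proof (intro kronecker_cycle [OF \<Phi> f(1), symmetric] singular_relcycle_square_chain G)
    show "G (1, t) = G (0, t)" for t
      using per [of "(0, t)" 1 0] by simp
    show "G (s, 1) = G (s, 0)" for s
      using per [of "(s, 0)" 0 1] by simp
  qed
  finally show ?thesis
    by (simp only: F_def [abs_def])
qed

text \<open>The torus \<open>F\<close> is homologous to the image of a cycle on the sphere, where
  the two pairings are proportional. On \<open>F\<close> both are the same positive multiple of
  their values on \<open>a\<close>.\<close>

lemma proportional_on_toroidal_classes:
  fixes M :: "'a::topological_space set"
    and A :: "('a, complex^'n::finite) chart set"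
    and \<omega> :: "('a, complex^'n) two_tensor"
  assumes M: "path_connected M" "x0 \<in> M"
    and no_Z2: "\<not> (\<exists>H. subgroup H (fundamental_group M x0) \<and>
                (fundamental_group M x0)\<lparr>carrier := H\<rparr> \<cong> integer_group \<times>\<times> integer_group)"
    and sph: "proportional_on M A \<omega> l (spherical_classes M)"
  shows "proportional_on M A \<omega> l (toroidal_classes M \<alpha>)"
  unfolding proportional_on_def
proof (intro allI impI ballI)
  fix \<Omega> J C a
  let ?X = "top_of_set M"
  assume classes: "de_rham_class M A \<omega> \<Omega> \<and> compatible_acs A \<omega> J \<and> first_chern_class M A J C"
    and "a \<in> toroidal_classes M \<alpha>"
  then obtain w where w: "continuous_map (top_of_set torus) ?X w"
    and a: "a = hom_induced 2 (top_of_set torus) {} ?X {} w torus_fundamental_class"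
    by (auto simp: toroidal_classes_def)
  have \<Omega>: "\<Omega> \<in> cohomology 2 ?X" and C: "C \<in> cohomology 2 ?X"
    using classes by (simp_all add: de_rham_class_def first_chern_class_def)
  \<comment> \<open>The lift of \<open>w\<close> to the universal cover of the torus.\<close>
  define G where "G = w \<circ> torus_param"
  have G: "continuous_map euclidean ?X G"
    unfolding G_def using continuous_map_torus_param w by (rule continuous_map_compose)
  then have G': "continuous_on UNIV G" "range G \<subseteq> M"
    by (auto simp: continuous_map_in_subtopology)
  have per: "G (y + (of_int i, of_int j)) = G y" for y i j
    by (simp add: G_def torus_param_translate)
  obtain c where "path c" "path_image c \<subseteq> M" "pathstart c = x0" "pathfinish c = G (0, 0)"
    using M G'(2) unfolding path_connected_def by (metis range_subsetD)
  then obtain m n :: int where mn: "(m, n) \<noteq> (0, 0)"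
    "homotopic_loops M (\<lambda>t. G (t *\<^sub>R (of_int m, of_int n))) (\<lambda>_. x0)"
    using torus_loop_null_homotopic [OF _ _ _ _ G' per no_Z2] by blast
  \<comment> \<open>The bottom side of the square now follows the null-homotopic loop. The second
    direction is \<open>(m, n)\<close> turned by a right angle, which makes the determinant
    \<open>m\<^sup>2 + n\<^sup>2\<close>.\<close>
  define F where "F y = G (fst y *\<^sub>R (of_int m, of_int n) + snd y *\<^sub>R (- of_int n, of_int m))" for y
  have "continuous_on UNIV F"
    unfolding F_def [abs_def] by (intro continuous_on_compose2 [OF G'(1)] continuous_intros) auto
  then have F: "continuous_map euclidean ?X F"
    using G'(2) by (auto simp: continuous_map_in_subtopology F_def)
  have sides: "F (1, t) = F (0, t)" for t
    using per [of "t *\<^sub>R (- of_int n, of_int m)" m n] by (simp add: F_def add.commute)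
  have ends: "F (s, 1) = F (s, 0)" for s
    using per [of "s *\<^sub>R (of_int m, of_int n)" "- n" m] by (simp add: F_def)
  obtain h z where h: "continuous_map (nsphere 2) ?X h" and z: "singular_relcycle 2 (nsphere 2) {} z"
    and hz: "homologous_rel_set 2 ?X {} (square_chain F) = homologous_rel_set 2 ?X {} (chain_map 2 h z)"
  proof (rule null_loop_square_chain_spherical [of F M x0])
    show "continuous_on unit_square F"
      using \<open>continuous_on UNIV F\<close> continuous_on_subset by blast
    show "F ` unit_square \<subseteq> M"
      using G'(2) by (auto simp: F_def)
    show "homotopic_loops M (\<lambda>s. F (s, 0)) (\<lambda>_. x0)"
      using mn(2) by (simp add: F_def)
  qed (use sides ends in auto)
  have "hom_induced 2 (nsphere 2) {} ?X {} h sphere_fundamental_class \<in> spherical_classes M"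
    using h by (auto simp: spherical_classes_def)
  then have "kronecker \<Omega> (homologous_rel_set 2 ?X {} (square_chain F))
      = l * of_int (kronecker C (homologous_rel_set 2 ?X {} (square_chain F)))"
    unfolding hz using sph classes
    by (intro kronecker_proportional_sphere_image [OF \<Omega> C h _ z]) (auto simp: proportional_on_def)
  moreover have "homologous_rel_set 2 ?X {} (square_chain G) = a"
    using hom_induced_torus [OF w] by (simp add: a G_def)
  moreover note kronecker_square_chain_rotation [OF \<Omega> G per, of m n]
    kronecker_square_chain_rotation [OF C G per, of m n]
  ultimately have "of_int (m\<^sup>2 + n\<^sup>2) * kronecker \<Omega> a = l * of_int ((m\<^sup>2 + n\<^sup>2) * kronecker C a)"
    by (simp only: F_def [abs_def] of_int_mult of_int_eq_id id_apply)
  \<comment> \<open>The reals have no torsion, so this factor can be cancelled although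
    \<open>F\<close> only represents a multiple of \<open>a\<close>.\<close>
  moreover have "m\<^sup>2 + n\<^sup>2 \<noteq> 0"
    using mn(1) by (auto simp: sum_power2_eq_zero_iff)
  ultimately show "kronecker \<Omega> a = l * of_int (kronecker C a)"
    by (auto simp: mult.left_commute [of l] simp del: of_int_add of_int_power)
qed

text \<open>Around each point a chart contains a ball, and segments in it pull back to paths. Being
  joined by a path is thus an equivalence relation with open classes, and a connected space has only
  one.\<close>

lemma path_connected_manifold:
  fixes M :: "'a::topological_space set" and A :: "('a, 'e::euclidean_space) chart set"
  assumes "smooth_manifold M A" "connected M"
  shows "path_connected M"
  unfolding path_connected_component
proof (intro ballI)
  fix x y
  assume "x \<in> M" "y \<in> M"
  with \<open>connected M\<close> show "path_component M x y"
  proof (rule connected_equivalence_relation)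
    fix a
    assume a: "a \<in> M"
    have "(\<Union>d\<in>A. fst d) = M"
      using assms(1) by (simp add: smooth_manifold_def)
    then obtain d where d: "d \<in> A" "a \<in> fst d"
      using a by blast
    define U where "U = fst d"
    define \<phi> where "\<phi> = snd d"
    have U: "a \<in> U" "openin (top_of_set M) U" "open (\<phi> ` U)"
      and \<phi>: "homeomorphic_map (top_of_set U) (top_of_set (\<phi> ` U)) \<phi>"
      using assms(1) d unfolding smooth_manifold_def U_def \<phi>_def by simp_all
    obtain \<psi> where "homeomorphic_maps (top_of_set U) (top_of_set (\<phi> ` U)) \<phi> \<psi>"
      using \<phi> unfolding homeomorphic_map_maps by blast
    then have \<psi>: "continuous_on (\<phi> ` U) \<psi>" "continuous_on U \<phi>" "\<And>x. x \<in> U \<Longrightarrow> \<psi> (\<phi> x) = x"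
      by (simp_all add: homeomorphic_maps_def continuous_map_in_subtopology)
    obtain e where e: "e > 0" "ball (\<phi> a) e \<subseteq> \<phi> ` U"
      using U open_contains_ball by blast
    have "path_component M a x" if x: "x \<in> U" "\<phi> x \<in> ball (\<phi> a) e" for x
    proof -
      let ?g = "linepath (\<phi> a) (\<phi> x)"
      have "path_image ?g \<subseteq> ball (\<phi> a) e"
        unfolding path_image_linepath by (rule closed_segment_subset) (use e x in auto)
      then have g: "path_image ?g \<subseteq> \<phi> ` U"
        using e by blast
      have "path (\<psi> \<circ> ?g)"
        using g continuous_on_subset [OF \<psi>(1)] by (intro path_continuous_image) auto
      moreover have "path_image (\<psi> \<circ> ?g) \<subseteq> M"
        using g \<psi>(3) openin_imp_subset [OF U(2)] by (fastforce simp: path_image_compose)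
      ultimately show ?thesis
        using \<psi>(3) U x unfolding path_component_def
        by (intro exI [of _ "\<psi> \<circ> ?g"]) (auto simp: pathstart_compose pathfinish_compose)
    qed
    moreover have "openin (top_of_set M) (U \<inter> \<phi> -` ball (\<phi> a) e)"
      using openin_trans [OF continuous_openin_preimage_gen [OF \<psi>(2) open_ball] U(2)] by simp
    ultimately show "\<exists>T. openin (top_of_set M) T \<and> a \<in> T \<and> (\<forall>x\<in>T. path_component M a x)"
      using U e by (intro exI [of _ "U \<inter> \<phi> -` ball (\<phi> a) e"]) auto
  qed (auto intro: path_component_sym path_component_trans)
qed

theorem proposition3p4:
  fixes M :: "'a::topological_space set"
    and A :: "('a, complex^'n::finite) chart set"
    and \<omega> :: "('a, complex^'n) two_tensor"
    and l :: real and x0 :: 'a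
  assumes "closed_symplectic_manifold M A \<omega>"
    and "connected M"
    and "\<not> simply_connected M"
    and "x0 \<in> M"
    and "\<not> (\<exists>H. subgroup H (fundamental_group M x0) \<and>
                (fundamental_group M x0)\<lparr>carrier := H\<rparr> \<cong> integer_group \<times>\<times> integer_group)"
  shows "(spherically_monotone M A \<omega> l \<longrightarrow> toroidally_monotone M A \<omega> l) \<and>
         (spherically_negative_monotone M A \<omega> l \<longrightarrow> toroidally_negative_monotone M A \<omega> l)"
proof -
  have "path_connected M"
    using assms(1,2) by (auto simp: closed_symplectic_manifold_def intro: path_connected_manifold)
  then show ?thesis
    using proportional_on_toroidal_classes [OF _ assms(4,5), of A \<omega> l]
    by (simp add: spherically_monotone_def toroidally_monotone_def
        spherically_negative_monotone_def toroidally_negative_monotone_def)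
qed

end
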